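(* If the Prime Ideal Theorem holds, then the functors $\mathbf U_{\rm Pervin}:\mathbf{CPervin}\to\mathbf{Spec}$ and $\mathbf{KO}:\mathbf{Spec}\to\mathbf{CPervin}$ establish an isomorphism of categories between $\mathbf{Spec}$ (spectral spaces) and $\mathbf{CPervin}$ ($T_0$ complete Pervin spaces).
   Context: Prime Ideal Theorem: every proper ideal of a bounded distributive lattice extends to a prime ideal. (The Axiom of Choice is not assumed.) A Pervin space is a pair $(X,\mathcal S)$ with $X$ a set and $\mathcal S$ a bounded sublattice of $\mathcal P(X)$. A morphism $(X,\mathcal S)\to(Y,\mathcal T)$ is a function $f$ with $f^{-1}(T)\in\mathcal S$ for all $T\in\mathcal T$. $\Omega_{\mathcal S}(X)$ is the topology generated by $\mathcal S$; $(X,\mathcal S)$ is $T_0$ if this topology is $T_0$. $f$ is dense if $f[X]$ is dense in $(Y,\Omega_{\mathcal T}(Y))$, and it is an extremal monomorphism if and only if it is injective and every $S\in\mathcal S$ is $f^{-1}(T)$ for some $T\in\mathcal T$. $(X,\mathcal S)$ is symmetric if $\mathcal S$ is a Boolean algebra. A symmetric Pervin space is complete if every dense extremal monomorphism from it into a $T_0$ symmetric Pervin space is an isomorphism. A Pervin space $(X,\mathcal S)$ is complete if $(X,\overline{\mathcal S})$ is complete, where $\overline{\mathcal S}$ is the Boolean subalgebra of $\mathcal P(X)$ generated by $\mathcal S$. $\mathbf{CPervin}$ is the full subcategory of Pervin spaces determined by the $T_0$ complete ones. A topological space is spectral if it is sober and its compact open subsets are closed under finite intersections (including the empty one) and form a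 basis of the topology. $\mathbf{Spec}$ is the category of spectral spaces and continuous functions for which preimages of compact open subsets are compact. $\mathbf U_{\rm Pervin}$ sends $(X,\mathcal S)$ to $(X,\Omega_{\mathcal S}(X))$; $\mathbf{KO}$ sends a spectral space $(X,\tau)$ to the set $X$ equipped with the lattice of compact open subsets of $(X,\tau)$; both leave underlying functions unchanged. *)

theory Defs
  imports "HOL-Analysis.Analysis" "HOL-Algebra.Lattice"
begin

section \<open>Categories presented by hom-sets\<close>

text \<open>Composition and the arrow part of a functor receive their source and target objects as
  arguments, so hom-sets of different pairs of objects need not be disjoint.\<close>

record ('o, 'm) cat =
  Ob :: "'o set"
  Hom :: "'o \<Rightarrow> 'o \<Rightarrow> 'm set"
  Ident :: "'o \<Rightarrow> 'm"
  Comp :: "'o \<Rightarrow> 'o \<Rightarrow> 'o \<Rightarrow> 'm \<Rightarrow> 'm \<Rightarrow> 'm"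

locale category =
  fixes \<C> :: "('o, 'm) cat"
  assumes Ident_closed: "A \<in> Ob \<C> \<Longrightarrow> Ident \<C> A \<in> Hom \<C> A A"
    and Comp_closed:
      "\<lbrakk>A \<in> Ob \<C>; B \<in> Ob \<C>; C \<in> Ob \<C>; f \<in> Hom \<C> A B; g \<in> Hom \<C> B C\<rbrakk>
        \<Longrightarrow> Comp \<C> A B C g f \<in> Hom \<C> A C"
    and Comp_Ident_left:
      "\<lbrakk>A \<in> Ob \<C>; B \<in> Ob \<C>; f \<in> Hom \<C> A B\<rbrakk> \<Longrightarrow> Comp \<C> A B B (Ident \<C> B) f = f"
    and Comp_Ident_right:
      "\<lbrakk>A \<in> Ob \<C>; B \<in> Ob \<C>; f \<in> Hom \<C> A B\<rbrakk> \<Longrightarrow> Comp \<C> A A B f (Ident \<C> A) = f"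
    and Comp_assoc:
      "\<lbrakk>A \<in> Ob \<C>; B \<in> Ob \<C>; C \<in> Ob \<C>; D \<in> Ob \<C>;
        f \<in> Hom \<C> A B; g \<in> Hom \<C> B C; h \<in> Hom \<C> C D\<rbrakk>
        \<Longrightarrow> Comp \<C> A C D h (Comp \<C> A B C g f) = Comp \<C> A B D (Comp \<C> B C D h g) f"

record ('o, 'm, 'p, 'n) func =
  ob_map :: "'o \<Rightarrow> 'p"
  arr_map :: "'o \<Rightarrow> 'o \<Rightarrow> 'm \<Rightarrow> 'n"

locale category_functor = source: category \<C> + target: category \<D>
  for \<C> :: "('o, 'm) cat" and \<D> :: "('p, 'n) cat" +
  fixes F :: "('o, 'm, 'p, 'n) func"
  assumes ob_map_closed: "A \<in> Ob \<C> \<Longrightarrow> ob_map F A \<in> Ob \<D>"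
    and arr_map_closed:
      "\<lbrakk>A \<in> Ob \<C>; B \<in> Ob \<C>; f \<in> Hom \<C> A B\<rbrakk>
        \<Longrightarrow> arr_map F A B f \<in> Hom \<D> (ob_map F A) (ob_map F B)"
    and arr_map_Ident: "A \<in> Ob \<C> \<Longrightarrow> arr_map F A A (Ident \<C> A) = Ident \<D> (ob_map F A)"
    and arr_map_Comp:
      "\<lbrakk>A \<in> Ob \<C>; B \<in> Ob \<C>; C \<in> Ob \<C>; f \<in> Hom \<C> A B; g \<in> Hom \<C> B C\<rbrakk>
        \<Longrightarrow> arr_map F A C (Comp \<C> A B C g f) =
            Comp \<D> (ob_map F A) (ob_map F B) (ob_map F C) (arr_map F B C g) (arr_map F A B f)"

locale category_isomorphism =
  fwd: category_functor \<C> \<D> F + bwd: category_functor \<D> \<C> G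
  for \<C> :: "('o, 'm) cat" and \<D> :: "('p, 'n) cat"
    and F :: "('o, 'm, 'p, 'n) func" and G :: "('p, 'n, 'o, 'm) func" +
  assumes bwd_fwd_ob: "A \<in> Ob \<C> \<Longrightarrow> ob_map G (ob_map F A) = A"
    and bwd_fwd_arr:
      "\<lbrakk>A \<in> Ob \<C>; B \<in> Ob \<C>; f \<in> Hom \<C> A B\<rbrakk>
        \<Longrightarrow> arr_map G (ob_map F A) (ob_map F B) (arr_map F A B f) = f"
    and fwd_bwd_ob: "X \<in> Ob \<D> \<Longrightarrow> ob_map F (ob_map G X) = X"
    and fwd_bwd_arr:
      "\<lbrakk>X \<in> Ob \<D>; Y \<in> Ob \<D>; g \<in> Hom \<D> X Y\<rbrakk>
        \<Longrightarrow> arr_map F (ob_map G X) (ob_map G Y) (arr_map G X Y g) = g"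

definition full_subcategory :: "('o, 'm) cat \<Rightarrow> 'o set \<Rightarrow> ('o, 'm) cat" where
  "full_subcategory \<C> P = \<C>\<lparr>Ob := Ob \<C> \<inter> P\<rparr>"


section \<open>The Prime Ideal Theorem\<close>

definition distributive_lattice :: "('b, 'c) gorder_scheme \<Rightarrow> bool" where
  "distributive_lattice L \<longleftrightarrow> bounded_lattice L \<and>
    (\<forall>x\<in>carrier L. \<forall>y\<in>carrier L. \<forall>z\<in>carrier L.
      x \<sqinter>\<^bsub>L\<^esub> (y \<squnion>\<^bsub>L\<^esub> z) = (x \<sqinter>\<^bsub>L\<^esub> y) \<squnion>\<^bsub>L\<^esub> (x \<sqinter>\<^bsub>L\<^esub> z))"

definition lattice_ideal :: "('b, 'c) gorder_scheme \<Rightarrow> 'b set \<Rightarrow> bool" where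
  "lattice_ideal L I \<longleftrightarrow> I \<subseteq> carrier L \<and> I \<noteq> {} \<and>
    (\<forall>x\<in>I. \<forall>y\<in>carrier L. y \<sqsubseteq>\<^bsub>L\<^esub> x \<longrightarrow> y \<in> I) \<and>
    (\<forall>x\<in>I. \<forall>y\<in>I. x \<squnion>\<^bsub>L\<^esub> y \<in> I)"

definition proper_ideal :: "('b, 'c) gorder_scheme \<Rightarrow> 'b set \<Rightarrow> bool" where
  "proper_ideal L I \<longleftrightarrow> lattice_ideal L I \<and> I \<noteq> carrier L"

definition prime_ideal :: "('b, 'c) gorder_scheme \<Rightarrow> 'b set \<Rightarrow> bool" where
  "prime_ideal L P \<longleftrightarrow> proper_ideal L P \<and>
    (\<forall>x\<in>carrier L. \<forall>y\<in>carrier L. x \<sqinter>\<^bsub>L\<^esub> y \<in> P \<longrightarrow> x \<in> P \<or> y \<in> P)"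

text \<open>The principle for all lattices whose carrier is a set of elements of the given type. (It is
  provable in HOL, which has a choice operator.)\<close>

definition prime_ideal_theorem :: "'b itself \<Rightarrow> bool" where
  "prime_ideal_theorem _ \<longleftrightarrow>
    (\<forall>(L :: 'b gorder) I. distributive_lattice L \<and> proper_ideal L I \<longrightarrow>
      (\<exists>P. prime_ideal L P \<and> I \<subseteq> P))"


section \<open>Pervin spaces\<close>

record 'a pervin =
  points :: "'a set"
  blocks :: "'a set set"

definition pervin_space :: "'a pervin \<Rightarrow> bool" where
  "pervin_space A \<longleftrightarrow> blocks A \<subseteq> Pow (points A) \<and> {} \<in> blocks A \<and> points A \<in> blocks A \<and>
    (\<forall>S\<in>blocks A. \<forall>T\<in>blocks A. S \<inter> T \<in> blocks A \<and> S \<union> T \<in> blocks A)"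

text \<open>Morphisms are extensional functions, so that equality of morphisms is equality
  on the underlying set.\<close>

definition pervin_hom :: "'a pervin \<Rightarrow> 'b pervin \<Rightarrow> ('a \<Rightarrow> 'b) set" where
  "pervin_hom A B = {f \<in> points A \<rightarrow>\<^sub>E points B. \<forall>T\<in>blocks B. f -` T \<inter> points A \<in> blocks A}"

definition Pervin :: "('a pervin, 'a \<Rightarrow> 'a) cat" where
  "Pervin = \<lparr>Ob = {A. pervin_space A},
             Hom = pervin_hom,
             Ident = (\<lambda>A. \<lambda>x\<in>points A. x),
             Comp = (\<lambda>A B C g f. compose (points A) g f)\<rparr>"

text \<open>The underlying set of this topology is \<open>\<Union>(blocks A)\<close>, which is \<open>points A\<close> for
  a Pervin space.\<close>

definition pervin_topology :: "'a pervin \<Rightarrow> 'a topology" where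
  "pervin_topology A = topology_generated_by (blocks A)"

definition pervin_T0 :: "'a pervin \<Rightarrow> bool" where
  "pervin_T0 A \<longleftrightarrow> t0_space (pervin_topology A)"

definition dense_map :: "'a pervin \<Rightarrow> 'b pervin \<Rightarrow> ('a \<Rightarrow> 'b) \<Rightarrow> bool" where
  "dense_map A B f \<longleftrightarrow> pervin_topology B closure_of (f ` points A) = points B"

definition extremal_mono :: "'a pervin \<Rightarrow> 'b pervin \<Rightarrow> ('a \<Rightarrow> 'b) \<Rightarrow> bool" where
  "extremal_mono A B f \<longleftrightarrow> f \<in> pervin_hom A B \<and> inj_on f (points A) \<and>
    (\<forall>S\<in>blocks A. \<exists>T\<in>blocks B. S = f -` T \<inter> points A)"

definition pervin_iso :: "'a pervin \<Rightarrow> 'b pervin \<Rightarrow> ('a \<Rightarrow> 'b) \<Rightarrow> bool" where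
  "pervin_iso A B f \<longleftrightarrow> f \<in> pervin_hom A B \<and>
    (\<exists>g\<in>pervin_hom B A. compose (points A) g f = (\<lambda>x\<in>points A. x) \<and>
                        compose (points B) f g = (\<lambda>y\<in>points B. y))"

definition symmetric_pervin :: "'a pervin \<Rightarrow> bool" where
  "symmetric_pervin A \<longleftrightarrow> pervin_space A \<and> algebra (points A) (blocks A)"

text \<open>A formula of HOL cannot quantify over types, so the spaces into which \<open>A\<close> is embedded
  have to live in a fixed type. Completeness of a space over \<^typ>\<open>'a\<close> is tested against the spaces
  over \<^typ>\<open>'a set set\<close>. This is no restriction: a point \<open>y\<close> of a \<open>T\<^sub>0\<close> symmetric
  extension is determined by the set of traces on \<open>A\<close> of the blocks containing \<open>y\<close>, and
  theorem \<open>symmetric_complete_imp_complete_in\<close> below derives the same property for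
  extensions over every other type.\<close>

definition symmetric_complete_in :: "'b itself \<Rightarrow> 'a pervin \<Rightarrow> bool" where
  "symmetric_complete_in _ A \<longleftrightarrow> symmetric_pervin A \<and>
    (\<forall>(B :: 'b pervin) f. symmetric_pervin B \<and> pervin_T0 B \<and> dense_map A B f \<and> extremal_mono A B f
      \<longrightarrow> pervin_iso A B f)"

definition symmetric_complete :: "'a pervin \<Rightarrow> bool" where
  "symmetric_complete A \<longleftrightarrow> symmetric_complete_in TYPE('a set set) A"

definition symmetrization :: "'a pervin \<Rightarrow> 'a pervin" where
  "symmetrization A = \<lparr>points = points A, blocks = algebra (points A) hull blocks A\<rparr>"

definition complete_pervin :: "'a pervin \<Rightarrow> bool" where
  "complete_pervin A \<longleftrightarrow> pervin_space A \<and> symmetric_complete (symmetrization A)"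

definition CPervin :: "('a pervin, 'a \<Rightarrow> 'a) cat" where
  "CPervin = full_subcategory Pervin {A. pervin_T0 A \<and> complete_pervin A}"


section \<open>Spectral spaces\<close>

definition compact_opens :: "'a topology \<Rightarrow> 'a set set" where
  "compact_opens X = {K. openin X K \<and> compactin X K}"

definition irreducible_closed :: "'a topology \<Rightarrow> 'a set \<Rightarrow> bool" where
  "irreducible_closed X C \<longleftrightarrow> closedin X C \<and> C \<noteq> {} \<and>
    (\<forall>D E. closedin X D \<and> closedin X E \<and> C = D \<union> E \<longrightarrow> C = D \<or> C = E)"

definition sober_space :: "'a topology \<Rightarrow> bool" where
  "sober_space X \<longleftrightarrow>
    (\<forall>C. irreducible_closed X C \<longrightarrow> (\<exists>!x. x \<in> topspace X \<and> C = X closure_of {x}))"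

text \<open>For \<open>\<F> = {}\<close> the intersection below is the whole space.\<close>

definition spectral_space :: "'a topology \<Rightarrow> bool" where
  "spectral_space X \<longleftrightarrow> sober_space X \<and>
    (\<forall>\<F>. finite \<F> \<and> \<F> \<subseteq> compact_opens X \<longrightarrow> topspace X \<inter> \<Inter>\<F> \<in> compact_opens X) \<and>
    (\<forall>U. openin X U \<longrightarrow> (\<exists>\<K>\<subseteq>compact_opens X. U = \<Union>\<K>))"

definition spectral_hom :: "'a topology \<Rightarrow> 'b topology \<Rightarrow> ('a \<Rightarrow> 'b) set" where
  "spectral_hom X Y = {f \<in> extensional (topspace X). continuous_map X Y f \<and>
    (\<forall>K\<in>compact_opens Y. compactin X (f -` K \<inter> topspace X))}"

definition Spec :: "('a topology, 'a \<Rightarrow> 'a) cat" where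
  "Spec = \<lparr>Ob = {X. spectral_space X},
           Hom = spectral_hom,
           Ident = (\<lambda>X. \<lambda>x\<in>topspace X. x),
           Comp = (\<lambda>X Y Z g f. compose (topspace X) g f)\<rparr>"


section \<open>The two functors\<close>

definition U_Pervin :: "('a pervin, 'a \<Rightarrow> 'a, 'a topology, 'a \<Rightarrow> 'a) func" where
  "U_Pervin = \<lparr>ob_map = pervin_topology, arr_map = (\<lambda>A B f. f)\<rparr>"

definition KO :: "('a topology, 'a \<Rightarrow> 'a, 'a pervin, 'a \<Rightarrow> 'a) func" where
  "KO = \<lparr>ob_map = (\<lambda>X. \<lparr>points = topspace X, blocks = compact_opens X\<rparr>),
         arr_map = (\<lambda>X Y f. f)\<rparr>"


section \<open>Completeness does not depend on the type of the extensions\<close>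

lemma openin_pervin_topology:
  assumes "pervin_space A"
  shows "openin (pervin_topology A) U \<longleftrightarrow> (\<exists>\<K>\<subseteq>blocks A. U = \<Union>\<K>)"
proof
  assume "openin (pervin_topology A) U"
  then have "generate_topology_on (blocks A) U"
    by (simp add: pervin_topology_def openin_topology_generated_by_iff)
  then show "\<exists>\<K>\<subseteq>blocks A. U = \<Union>\<K>"
  proof induction
    case Empty
    show ?case by (rule exI[of _ "{}"]) simp
  next
    case (Int a b)
    then obtain \<K> \<L> where "\<K> \<subseteq> blocks A" "a = \<Union>\<K>" "\<L> \<subseteq> blocks A" "b = \<Union>\<L>" by blast
    moreover have "\<forall>S\<in>blocks A. \<forall>T\<in>blocks A. S \<inter> T \<in> blocks A"
      using assms by (simp add: pervin_space_def)
    ultimately show ?case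
      by (intro exI[of _ "{S \<inter> T |S T. S \<in> \<K> \<and> T \<in> \<L>}"]) blast
  next
    case (UN K)
    then obtain h where h: "\<And>k. k \<in> K \<Longrightarrow> h k \<subseteq> blocks A" "\<And>k. k \<in> K \<Longrightarrow> \<Union>(h k) = k"
      by metis
    have "\<Union>(\<Union>(h ` K)) = (\<Union>k\<in>K. \<Union>(h k))" by blast
    also have "\<dots> = \<Union>K" using h(2) by simp
    finally have "\<Union>K = \<Union>(\<Union>(h ` K))" by (rule sym)
    moreover have "\<Union>(h ` K) \<subseteq> blocks A" using h(1) by (rule UN_least)
    ultimately show ?case by (intro exI[of _ "\<Union>(h ` K)"] conjI)
  next
    case (Basis s)
    then show ?case by (intro exI[of _ "{s}"]) simp
  qed
next
  assume "\<exists>\<K>\<subseteq>blocks A. U = \<Union>\<K>"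
  then show "openin (pervin_topology A) U"
    unfolding pervin_topology_def by (metis openin_Union subsetD topology_generated_by_Basis)
qed

lemma topspace_pervin_topology:
  "pervin_space A \<Longrightarrow> topspace (pervin_topology A) = points A"
  by (auto simp: pervin_topology_def topology_generated_by_topspace pervin_space_def)

lemma pervin_T0_iff:
  assumes "pervin_space A"
  shows "pervin_T0 A \<longleftrightarrow>
    (\<forall>x\<in>points A. \<forall>y\<in>points A. x \<noteq> y \<longrightarrow> (\<exists>S\<in>blocks A. (x \<in> S) \<noteq> (y \<in> S)))"
  unfolding pervin_T0_def t0_space_def topspace_pervin_topology[OF assms]
    openin_pervin_topology[OF assms]
proof (intro iffI ballI impI)
  fix x y
  assume "\<forall>x\<in>points A. \<forall>y\<in>points A. x \<noteq> y \<longrightarrow>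
      (\<exists>U. (\<exists>\<K>\<subseteq>blocks A. U = \<Union>\<K>) \<and> (x \<notin> U) = (y \<in> U))"
    and "x \<in> points A" "y \<in> points A" "x \<noteq> y"
  then obtain \<K> where "\<K> \<subseteq> blocks A" "(x \<notin> \<Union>\<K>) = (y \<in> \<Union>\<K>)" by metis
  then show "\<exists>S\<in>blocks A. (x \<in> S) \<noteq> (y \<in> S)" by blast
next
  fix x y
  assume "\<forall>x\<in>points A. \<forall>y\<in>points A. x \<noteq> y \<longrightarrow> (\<exists>S\<in>blocks A. (x \<in> S) \<noteq> (y \<in> S))"
    and "x \<in> points A" "y \<in> points A" "x \<noteq> y"
  then obtain S where "S \<in> blocks A" "(x \<in> S) \<noteq> (y \<in> S)" by blast
  then show "\<exists>U. (\<exists>\<K>\<subseteq>blocks A. U = \<Union>\<K>) \<and> (x \<notin> U) = (y \<in> U)"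
    by (intro exI[of _ S]) (auto intro!: exI[of _ "{S}"])
qed

lemma dense_map_iff:
  assumes "pervin_space B"
  shows "dense_map A B f \<longleftrightarrow> (\<forall>T\<in>blocks B. T \<noteq> {} \<longrightarrow> T \<inter> f ` points A \<noteq> {})"
proof -
  have "dense_map A B f \<longleftrightarrow>
      (\<forall>U. openin (pervin_topology B) U \<and> U \<noteq> {} \<longrightarrow> U \<inter> f ` points A \<noteq> {})"
    unfolding dense_map_def
    using dense_intersects_open[of "pervin_topology B" "f ` points A"]
    by (simp add: topspace_pervin_topology[OF assms] Int_commute)
  also have "\<dots> \<longleftrightarrow> (\<forall>T\<in>blocks B. T \<noteq> {} \<longrightarrow> T \<inter> f ` points A \<noteq> {})"
    unfolding openin_pervin_topology[OF assms]
  proof (intro iffI ballI impI allI)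
    fix T assume "\<forall>U. (\<exists>\<K>\<subseteq>blocks B. U = \<Union>\<K>) \<and> U \<noteq> {} \<longrightarrow> U \<inter> f ` points A \<noteq> {}"
      "T \<in> blocks B" "T \<noteq> {}"
    moreover have "\<exists>\<K>\<subseteq>blocks B. T = \<Union>\<K>" using \<open>T \<in> blocks B\<close> by (intro exI[of _ "{T}"]) auto
    ultimately show "T \<inter> f ` points A \<noteq> {}" by blast
  qed blast
  finally show ?thesis .
qed

theorem symmetric_complete_imp_complete_in:
  fixes A :: "'a pervin"
  assumes "symmetric_complete A"
  shows "symmetric_complete_in TYPE('b) A"
  unfolding symmetric_complete_in_def
proof (intro conjI allI impI)
  show "symmetric_pervin A"
    using assms by (simp add: symmetric_complete_def symmetric_complete_in_def)
next
  fix B :: "'b pervin" and f :: "'a \<Rightarrow> 'b"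
  assume "symmetric_pervin B \<and> pervin_T0 B \<and> dense_map A B f \<and> extremal_mono A B f"
  then have B: "symmetric_pervin B" "pervin_T0 B" "dense_map A B f" "extremal_mono A B f"
    by auto
  then have pB: "pervin_space B" and alg: "algebra (points B) (blocks B)"
    by (auto simp: symmetric_pervin_def)
  have sub: "T \<subseteq> points B" if "T \<in> blocks B" for T
    using pB that by (auto simp: pervin_space_def)
  have f: "f \<in> points A \<rightarrow>\<^sub>E points B" "\<And>T. T \<in> blocks B \<Longrightarrow> f -` T \<inter> points A \<in> blocks A"
    "inj_on f (points A)" "\<And>S. S \<in> blocks A \<Longrightarrow> \<exists>T\<in>blocks B. S = f -` T \<inter> points A"
    using B(4) by (auto simp: extremal_mono_def pervin_hom_def)
  define tr where "tr T = f -` T \<inter> points A" for T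
  have tr_inj: "T = T'" if T: "T \<in> blocks B" "T' \<in> blocks B" "tr T = tr T'" for T T'
  proof -
    interpret algebra "points B" "blocks B" by (rule alg)
    have "(T - T') \<union> (T' - T) \<in> blocks B" using T by auto
    moreover have "((T - T') \<union> (T' - T)) \<inter> f ` points A = {}"
      using T(3) by (auto simp: tr_def)
    ultimately have "(T - T') \<union> (T' - T) = {}"
      using B(3) unfolding dense_map_iff[OF pB] by metis
    then show ?thesis by auto
  qed
  define g where "g y = {tr T |T. T \<in> blocks B \<and> y \<in> T}" for y
  have mem_g: "tr T \<in> g y \<longleftrightarrow> y \<in> T" if "T \<in> blocks B" for T y
    using tr_inj that by (auto simp: g_def)
  have g: "inj_on g (points B)"
  proof (rule inj_onI, rule ccontr)
    fix x y assume "x \<in> points B" "y \<in> points B" "g x = g y" "x \<noteq> y"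
    then show False using B(2) mem_g unfolding pervin_T0_iff[OF pB] by metis
  qed
  have gim: "g y \<in> g ` T \<longleftrightarrow> y \<in> T" if "T \<in> blocks B" "y \<in> points B" for T y
    using inj_on_image_mem_iff[OF g that(2) sub[OF that(1)]] .
  define B' where "B' = \<lparr>points = g ` points B, blocks = (`) g ` blocks B\<rparr>"
  have B'_sel: "points B' = g ` points B" "blocks B' = (`) g ` blocks B"
    by (simp_all add: B'_def)
  define f' where "f' = compose (points A) g f"
  have pB': "pervin_space B'"
    unfolding pervin_space_def B'_sel
  proof (intro conjI ballI)
    fix S T assume "S \<in> (`) g ` blocks B" "T \<in> (`) g ` blocks B"
    then obtain S' T' where ST: "S' \<in> blocks B" "T' \<in> blocks B" "S = g ` S'" "T = g ` T'" by auto
    then have "S \<inter> T = g ` (S' \<inter> T')" "S \<union> T = g ` (S' \<union> T')"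
      using inj_on_image_Int[OF g sub sub] by auto
    then show "S \<inter> T \<in> (`) g ` blocks B" "S \<union> T \<in> (`) g ` blocks B"
      using ST pB by (auto simp: pervin_space_def)
  qed (use pB in \<open>auto simp: pervin_space_def\<close>)
  have "algebra (points B') (blocks B')"
    unfolding algebra_iff_Un
  proof (intro conjI ballI)
    fix a assume "a \<in> blocks B'"
    then obtain T where T: "T \<in> blocks B" "a = g ` T" by (auto simp: B'_sel)
    then have "points B' - a = g ` (points B - T)"
      using inj_on_image_set_diff[OF g _ sub[OF T(1)], of "points B"] by (auto simp: B'_sel)
    moreover have "points B - T \<in> blocks B"
      using alg T by (auto simp: algebra_iff_Un)
    ultimately show "points B' - a \<in> blocks B'" by (simp add: B'_sel)
  qed (use pB' in \<open>auto simp: pervin_space_def\<close>)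
  then have sB': "symmetric_pervin B'" using pB' by (simp add: symmetric_pervin_def)
  have tB': "pervin_T0 B'"
    unfolding pervin_T0_iff[OF pB'] B'_sel
  proof (intro ballI impI)
    fix x y assume "x \<in> g ` points B" "y \<in> g ` points B" "x \<noteq> y"
    then obtain u v where uv: "u \<in> points B" "v \<in> points B" "x = g u" "y = g v" "u \<noteq> v" by auto
    then obtain T where "T \<in> blocks B" "(u \<in> T) \<noteq> (v \<in> T)"
      using B(2) unfolding pervin_T0_iff[OF pB] by blast
    then show "\<exists>S\<in>(`) g ` blocks B. (x \<in> S) \<noteq> (y \<in> S)"
      using uv gim by blast
  qed
  have f'_im: "f' ` points A = g ` f ` points A"
    by (auto simp: f'_def compose_def)
  have dB': "dense_map A B' f'"
    unfolding dense_map_iff[OF pB'] f'_im B'_sel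
  proof (intro ballI impI)
    fix U assume "U \<in> (`) g ` blocks B" "U \<noteq> {}"
    then obtain T where T: "T \<in> blocks B" "T \<noteq> {}" "U = g ` T" by auto
    then have "T \<inter> f ` points A \<noteq> {}" using B(3) unfolding dense_map_iff[OF pB] by auto
    then obtain y where "y \<in> T" "y \<in> f ` points A" by auto
    then have "g y \<in> U \<inter> g ` f ` points A" using T(3) by auto
    then show "U \<inter> g ` f ` points A \<noteq> {}" by auto
  qed
  have f_in: "f x \<in> points B" if "x \<in> points A" for x using f(1) that by auto
  have pre: "f' -` (g ` T) \<inter> points A = f -` T \<inter> points A" if "T \<in> blocks B" for T
  proof -
    have *: "f' x \<in> g ` T \<longleftrightarrow> f x \<in> T" if "x \<in> points A" for x
      using gim[OF \<open>T \<in> blocks B\<close> f_in[OF that]] that by (simp add: f'_def compose_def)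
    show ?thesis by (rule Set.set_eqI) (metis * Int_iff vimage_eq)
  qed
  have eB': "extremal_mono A B' f'"
    unfolding extremal_mono_def pervin_hom_def B'_sel
  proof (intro conjI CollectI ballI)
    show "f' \<in> points A \<rightarrow>\<^sub>E g ` points B"
      using f_in by (auto simp: f'_def compose_def)
    show "f' -` T \<inter> points A \<in> blocks A" if "T \<in> (`) g ` blocks B" for T
      using that pre f(2) by auto
    show "inj_on f' (points A)"
      using f(3) f_in g by (auto simp: f'_def compose_def inj_on_def)
    show "\<exists>T\<in>(`) g ` blocks B. S = f' -` T \<inter> points A" if "S \<in> blocks A" for S
    proof -
      obtain T where "T \<in> blocks B" "S = f -` T \<inter> points A" using f(4)[OF \<open>S \<in> blocks A\<close>] by blast
      then have "S = f' -` (g ` T) \<inter> points A" "g ` T \<in> (`) g ` blocks B"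
        using pre by simp_all
      then show ?thesis by (rule bexI)
    qed
  qed
  have "pervin_iso A B' f'"
    using assms sB' tB' dB' eB' by (auto simp: symmetric_complete_def symmetric_complete_in_def)
  then obtain h where h: "h \<in> pervin_hom B' A" "compose (points A) h f' = (\<lambda>x\<in>points A. x)"
      "compose (points B') f' h = (\<lambda>y\<in>points B'. y)"
    unfolding pervin_iso_def by blast
  define k where "k = compose (points B) h g"
  have h_in: "h (g y) \<in> points A" if "y \<in> points B" for y
    using h(1) that by (auto simp: pervin_hom_def B'_sel)
  have hf: "h (g (f x)) = x" if "x \<in> points A" for x
    using fun_cong[OF h(2), of x] that by (simp add: compose_def f'_def)
  have fh: "f (h (g y)) = y" if "y \<in> points B" for y
  proof -
    have "g (f (h (g y))) = g y"
      using fun_cong[OF h(3), of "g y"] that h_in[OF that] by (simp add: compose_def f'_def B'_sel)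
    then show ?thesis using g f_in[OF h_in[OF that]] that by (auto dest: inj_onD)
  qed
  have "k \<in> pervin_hom B A"
    unfolding pervin_hom_def
  proof (intro CollectI conjI ballI)
    show "k \<in> points B \<rightarrow>\<^sub>E points A" using h_in by (auto simp: k_def compose_def)
    fix S assume "S \<in> blocks A"
    then obtain T where T: "T \<in> blocks B" "S = f -` T \<inter> points A" using f(4) by blast
    then have "k -` S \<inter> points B = T"
      using fh h_in sub[OF T(1)] by (auto simp: k_def compose_def)
    then show "k -` S \<inter> points B \<in> blocks B" using T by simp
  qed
  moreover have "compose (points A) k f = (\<lambda>x\<in>points A. x)"
    using hf f_in by (auto simp: k_def compose_def fun_eq_iff restrict_def)
  moreover have "compose (points B) f k = (\<lambda>y\<in>points B. y)"
    using fh by (auto simp: k_def compose_def fun_eq_iff restrict_def)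
  ultimately show "pervin_iso A B f"
    using B(4) unfolding pervin_iso_def extremal_mono_def by blast
qed

end

theory Submission
  imports Defs
begin

text \<open>Both functors leave points and functions alone, so everything rests on two questions: which
  Pervin spaces have as their blocks exactly the compact open sets of their own topology, which is
  then spectral, and why these are the \<open>T\<^sub>0\<close> complete ones. Prime filters of the lattice of blocks
  answer both. Every point \<open>x\<close> gives the prime filter of the blocks that contain it; call a Pervin
  space \<^emph>\<open>fixed\<close> if all its prime filters are of this form.

  A \<open>T\<^sub>0\<close> Pervin space is complete iff it is fixed
  (\<open>complete_pervin_iff_prime_filters_fixed\<close>). A prime filter of the blocks extends uniquely to an
  ultrafilter of the generated Boolean algebra, so it is enough to treat symmetric spaces. There, an
  ultrafilter that belongs to no point can be adjoined as a new point, which yields a proper dense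
  extension; and in a dense extension every point traces an ultrafilter on the original space, so
  that a point fixing this ultrafilter coincides with it by \<open>T\<^sub>0\<close>.

  In a fixed space every block is compact (\<open>compactin_blocks\<close>): if no finite part of an open cover
  covers the block, the blocks with a finite subcover form an ideal, the Prime Ideal Theorem gives a
  prime filter that contains the block and avoids the ideal, and its point is a point of the block
  outside the cover. So the compact open sets are the blocks, and the point fixing the prime filter
  of all blocks that meet an irreducible closed set is its generic point. Conversely, in a spectral
  space the points in no compact open set outside a given prime filter form an irreducible closed
  set, and its generic point fixes the prime filter (\<open>prime_filters_fixed_KO_space\<close>). This makes the
  functors inverse to each other on objects, and the two notions of morphism agree because the
  blocks are the compact open sets and form a basis.\<close>

section \<open>Prime filters of blocks\<close>

definition prime_filter :: "'a pervin \<Rightarrow> 'a set set \<Rightarrow> bool" where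
  "prime_filter A P \<longleftrightarrow> P \<subseteq> blocks A \<and> points A \<in> P \<and> {} \<notin> P \<and>
    (\<forall>S\<in>P. \<forall>T\<in>P. S \<inter> T \<in> P) \<and>
    (\<forall>S\<in>P. \<forall>T\<in>blocks A. S \<subseteq> T \<longrightarrow> T \<in> P) \<and>
    (\<forall>S\<in>blocks A. \<forall>T\<in>blocks A. S \<union> T \<in> P \<longrightarrow> S \<in> P \<or> T \<in> P)"

definition point_filter :: "'a pervin \<Rightarrow> 'a \<Rightarrow> 'a set set" where
  "point_filter A x = {S \<in> blocks A. x \<in> S}"

definition prime_filters_fixed :: "'a pervin \<Rightarrow> bool" where
  "prime_filters_fixed A \<longleftrightarrow> (\<forall>P. prime_filter A P \<longrightarrow> (\<exists>x\<in>points A. P = point_filter A x))"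

lemma pervin_spaceD:
  assumes "pervin_space A"
  shows "S \<in> blocks A \<Longrightarrow> S \<subseteq> points A" and "{} \<in> blocks A" and "points A \<in> blocks A"
    and "S \<in> blocks A \<Longrightarrow> T \<in> blocks A \<Longrightarrow> S \<inter> T \<in> blocks A"
    and "S \<in> blocks A \<Longrightarrow> T \<in> blocks A \<Longrightarrow> S \<union> T \<in> blocks A"
  using assms by (auto simp: pervin_space_def)

lemma prime_filterD:
  assumes "prime_filter A P"
  shows "S \<in> P \<Longrightarrow> S \<in> blocks A" and "points A \<in> P" and "{} \<notin> P"
    and "S \<in> P \<Longrightarrow> T \<in> P \<Longrightarrow> S \<inter> T \<in> P"
    and "S \<in> P \<Longrightarrow> T \<in> blocks A \<Longrightarrow> S \<subseteq> T \<Longrightarrow> T \<in> P"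
    and "S \<in> blocks A \<Longrightarrow> T \<in> blocks A \<Longrightarrow> S \<union> T \<in> P \<Longrightarrow> S \<in> P \<or> T \<in> P"
  using assms by (auto simp: prime_filter_def)

lemma prime_filter_point_filter:
  assumes "pervin_space A" "x \<in> points A"
  shows "prime_filter A (point_filter A x)"
  using assms by (auto simp: prime_filter_def point_filter_def pervin_space_def)

lemma finite_Union_blocks:
  assumes "pervin_space A" "finite \<F>" "\<F> \<subseteq> blocks A"
  shows "\<Union>\<F> \<in> blocks A"
  using assms(2,3) by (induction \<F>) (auto simp: pervin_spaceD[OF assms(1)])

lemma prime_filter_finite_Union:
  assumes "pervin_space A" "prime_filter A P" "finite \<F>" "\<F> \<subseteq> blocks A" "\<Union>\<F> \<in> P"
  shows "\<exists>S\<in>\<F>. S \<in> P"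
  using assms(3-5)
proof (induction \<F>)
  case empty
  then show ?case using prime_filterD(3)[OF assms(2)] by simp
next
  case (insert S \<F>)
  then have "S \<in> P \<or> \<Union>\<F> \<in> P"
    using prime_filterD(6)[OF assms(2), of S "\<Union>\<F>"] finite_Union_blocks[OF assms(1)] by simp
  then show ?case using insert by auto
qed

section \<open>Prime filters and the symmetrization\<close>

lemma symmetrization_sel [simp]:
  "points (symmetrization A) = points A"
  "blocks (symmetrization A) = algebra (points A) hull blocks A"
  by (simp_all add: symmetrization_def)

text \<open>The power set of the points is one of the algebras intersected in the hull, so the intersection
  is over a nonempty family and consists of sets of points; being an algebra then passes to it.\<close>

lemma symmetric_pervin_symmetrization:
  assumes "pervin_space A"
  shows "symmetric_pervin (symmetrization A)"
proof -
  have sub: "algebra (points A) hull blocks A \<subseteq> Pow (points A)"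
    using pervin_spaceD(1)[OF assms] by (intro hull_minimal algebra_Pow) blast
  have alg: "algebra (points A) (algebra (points A) hull blocks A)"
    unfolding algebra_iff_Un using sub by (auto simp: hull_def algebra_iff_Un)
  then interpret algebra "points A" "algebra (points A) hull blocks A" .
  have "pervin_space (symmetrization A)"
    using sub Int Un top empty_sets by (simp add: pervin_space_def)
  then show ?thesis using alg by (simp add: symmetric_pervin_def)
qed

lemma blocks_symmetrization: "S \<in> blocks A \<Longrightarrow> S \<in> blocks (symmetrization A)"
  by (simp add: hull_inc)

text \<open>The sets of points with property \<open>Q\<close> form an algebra that contains the blocks and hence the
  algebra they generate; this spares a normal form for the members of the latter.\<close>

lemma symmetrization_induct [consumes 2, case_names block compl Un]:
  assumes "pervin_space A" "b \<in> blocks (symmetrization A)"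
    and "\<And>S. S \<in> blocks A \<Longrightarrow> Q S"
    and "\<And>b. b \<subseteq> points A \<Longrightarrow> Q b \<Longrightarrow> Q (points A - b)"
    and "\<And>b c. b \<subseteq> points A \<Longrightarrow> c \<subseteq> points A \<Longrightarrow> Q b \<Longrightarrow> Q c \<Longrightarrow> Q (b \<union> c)"
  shows "Q b"
proof -
  have "algebra (points A) {b. b \<subseteq> points A \<and> Q b}"
    unfolding algebra_iff_Un using assms(3)[OF pervin_spaceD(2)[OF assms(1)]] assms(4,5) by auto
  moreover have "blocks A \<subseteq> {b. b \<subseteq> points A \<and> Q b}"
    using assms(3) pervin_spaceD(1)[OF assms(1)] by auto
  ultimately have "algebra (points A) hull blocks A \<subseteq> {b. b \<subseteq> points A \<and> Q b}"
    by (intro hull_minimal)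
  then show ?thesis using assms(2) by auto
qed

lemma symmetric_compl:
  assumes "symmetric_pervin A" "b \<in> blocks A"
  shows "points A - b \<in> blocks A"
  using assms by (auto simp: symmetric_pervin_def algebra_iff_Un)

lemma prime_filter_compl_iff:
  assumes A: "symmetric_pervin A" and U: "prime_filter A U" and b: "b \<in> blocks A"
  shows "points A - b \<in> U \<longleftrightarrow> b \<notin> U"
proof -
  have "b \<subseteq> points A" using A b by (auto simp: symmetric_pervin_def pervin_space_def)
  then have "b \<union> (points A - b) = points A" by auto
  then have "b \<in> U \<or> points A - b \<in> U"
    using prime_filterD(6)[OF U b symmetric_compl[OF A b]] prime_filterD(2)[OF U] by simp
  moreover have "\<not> (b \<in> U \<and> points A - b \<in> U)"
    using prime_filterD(3,4)[OF U] by (metis Diff_disjoint)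
  ultimately show ?thesis by blast
qed

lemma prime_filter_Un_iff:
  assumes A: "pervin_space A" and U: "prime_filter A U" and "b \<in> blocks A" "c \<in> blocks A"
  shows "b \<union> c \<in> U \<longleftrightarrow> b \<in> U \<or> c \<in> U"
proof
  show "b \<in> U \<or> c \<in> U" if "b \<union> c \<in> U" by (rule prime_filterD(6)[OF U assms(3,4) that])
  show "b \<union> c \<in> U" if "b \<in> U \<or> c \<in> U"
    using that prime_filterD(5)[OF U, of _ "b \<union> c"] pervin_spaceD(5)[OF A assms(3,4)] by blast
qed

text \<open>Prime filters of a Boolean algebra contain exactly one of a set and its complement, and for unions
  membership is determined by the parts; so the sets on which two of them agree form an algebra.\<close>

lemma prime_filter_symmetrization_determined:
  assumes A: "pervin_space A"
    and U: "prime_filter (symmetrization A) U" and V: "prime_filter (symmetrization A) V"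
    and agree: "U \<inter> blocks A = V \<inter> blocks A"
  shows "U = V"
proof -
  have sA: "symmetric_pervin (symmetrization A)" by (rule symmetric_pervin_symmetrization[OF A])
  then have pA: "pervin_space (symmetrization A)" by (simp add: symmetric_pervin_def)
  have "b \<in> blocks (symmetrization A) \<and> (b \<in> U \<longleftrightarrow> b \<in> V)"
    if "b \<in> blocks (symmetrization A)" for b
    using A that
  proof (induction rule: symmetrization_induct)
    case (block S)
    then show ?case using agree blocks_symmetrization by blast
  next
    case (compl b)
    then show ?case
      using symmetric_compl[OF sA, of b] prime_filter_compl_iff[OF sA U, of b]
        prime_filter_compl_iff[OF sA V, of b] by simp
  next
    case (Un b c)
    then show ?case
      using pervin_spaceD(5)[OF pA] prime_filter_Un_iff[OF pA U, of b c]
        prime_filter_Un_iff[OF pA V, of b c] by simp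
  qed
  then show ?thesis using prime_filterD(1)[OF U] prime_filterD(1)[OF V] by blast
qed

lemma prime_filter_restrict:
  assumes A: "pervin_space A" and U: "prime_filter (symmetrization A) U"
  shows "prime_filter A (U \<inter> blocks A)"
  unfolding prime_filter_def
proof (intro conjI ballI impI)
  note U' = prime_filterD[OF U]
  show "points A \<in> U \<inter> blocks A" using U'(2) pervin_spaceD(3)[OF A] by simp
  show "{} \<notin> U \<inter> blocks A" using U'(3) by simp
  fix S assume S: "S \<in> U \<inter> blocks A"
  show "S \<inter> T \<in> U \<inter> blocks A" if "T \<in> U \<inter> blocks A" for T
    using S that U'(4) pervin_spaceD(4)[OF A] by blast
  show "T \<in> U \<inter> blocks A" if "T \<in> blocks A" "S \<subseteq> T" for T
    using S that U'(5)[of S T] blocks_symmetrization[of T] by blast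
next
  fix S T assume "S \<in> blocks A" "T \<in> blocks A" "S \<union> T \<in> U \<inter> blocks A"
  then show "S \<in> U \<inter> blocks A \<or> T \<in> U \<inter> blocks A"
    using prime_filterD(6)[OF U, of S T] blocks_symmetrization[of _ A] by blast
qed blast

text \<open>The extension is generated by the differences \<open>S - T\<close> with \<open>S\<close> inside and \<open>T\<close> outside \<open>P\<close>. None of
  them is empty, since \<open>S \<subseteq> T\<close> would put \<open>T\<close> into \<open>P\<close>, and they are closed under intersection because
  \<open>P\<close> is prime. Every block or its complement is in the extension, and hence so is every set of the
  generated algebra or its complement.\<close>

lemma prime_filter_extend:
  assumes A: "pervin_space A" and P: "prime_filter A P"
  obtains U where "prime_filter (symmetrization A) U" "U \<inter> blocks A = P"
proof
  define U where
    "U = {b \<in> blocks (symmetrization A). \<exists>S\<in>P. \<exists>T\<in>blocks A - P. S - T \<subseteq> b}"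
  note A' = pervin_spaceD[OF A]
  note P' = prime_filterD[OF P]
  have sA: "symmetric_pervin (symmetrization A)" by (rule symmetric_pervin_symmetrization[OF A])
  then have pA: "pervin_space (symmetrization A)" by (simp add: symmetric_pervin_def)
  have in_U: "b \<in> U" if "b \<in> blocks (symmetrization A)" "S \<in> P" "T \<in> blocks A" "T \<notin> P" "S - T \<subseteq> b"
    for b S T
    using that by (auto simp: U_def)
  have U_up: "c \<in> U" if "b \<in> U" "b \<subseteq> c" "c \<in> blocks (symmetrization A)" for b c
    using that unfolding U_def by blast
  have U_Int: "b \<inter> c \<in> U" if bc: "b \<in> U" "c \<in> U" for b c
  proof -
    obtain S T where 1: "S \<in> P" "T \<in> blocks A" "T \<notin> P" "S - T \<subseteq> b"
      using bc(1) unfolding U_def by blast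
    obtain S' T' where 2: "S' \<in> P" "T' \<in> blocks A" "T' \<notin> P" "S' - T' \<subseteq> c"
      using bc(2) unfolding U_def by blast
    have "b \<inter> c \<in> blocks (symmetrization A)"
      using bc pervin_spaceD(4)[OF pA] unfolding U_def by blast
    moreover have "S \<inter> S' \<in> P" "T \<union> T' \<in> blocks A" "T \<union> T' \<notin> P"
      using 1 2 P'(4,6) A'(5) by blast+
    moreover have "(S \<inter> S') - (T \<union> T') \<subseteq> b \<inter> c" using 1 2 by blast
    ultimately show ?thesis by (rule in_U)
  qed
  have U_empty: "{} \<notin> U" using P'(5) unfolding U_def by blast
  have ultra: "b \<in> blocks (symmetrization A) \<and> (b \<in> U \<or> points A - b \<in> U)"
    if "b \<in> blocks (symmetrization A)" for b
    using A that
  proof (induction rule: symmetrization_induct)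
    case (block S)
    show ?case
    proof (cases "S \<in> P")
      case True
      then show ?thesis
        using in_U[of S S "{}"] P'(3) A'(2) blocks_symmetrization[OF block] by auto
    next
      case False
      then show ?thesis
        using in_U[of "points A - S" "points A" S] P'(2) blocks_symmetrization[OF block] block
          symmetric_compl[OF sA, of S] by auto
    qed
  next
    case (compl b)
    then have "points A - (points A - b) = b" by auto
    then show ?case using compl symmetric_compl[OF sA, of b] by auto
  next
    case (Un b c)
    have bc: "b \<union> c \<in> blocks (symmetrization A)" using Un pervin_spaceD(5)[OF pA] by blast
    show ?case
    proof (cases "b \<in> U \<or> c \<in> U")
      case True
      then show ?thesis using U_up[OF _ _ bc] bc by blast
    next
      case False
      then have "(points A - b) \<inter> (points A - c) \<in> U" using Un U_Int by blast
      then show ?thesis using bc by (simp add: Diff_Un)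
    qed
  qed
  have U_sub: "b \<in> blocks (symmetrization A)" if "b \<in> U" for b using that by (simp add: U_def)
  show "prime_filter (symmetrization A) U"
    unfolding prime_filter_def
  proof (intro conjI ballI impI)
    show "points (symmetrization A) \<in> U"
      using in_U[of "points A" "points A" "{}"] P'(2,3) A'(2) pervin_spaceD(3)[OF pA] by simp
    fix b c assume bc: "b \<in> blocks (symmetrization A)" "c \<in> blocks (symmetrization A)" "b \<union> c \<in> U"
    show "b \<in> U \<or> c \<in> U"
    proof (rule ccontr)
      assume "\<not> (b \<in> U \<or> c \<in> U)"
      then have "(b \<union> c) \<inter> ((points A - b) \<inter> (points A - c)) \<in> U"
        using ultra bc U_Int by blast
      moreover have "(b \<union> c) \<inter> ((points A - b) \<inter> (points A - c)) = {}" by blast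
      ultimately show False using U_empty by simp
    qed
  next
    fix b c assume "b \<in> U" "c \<in> blocks (symmetrization A)" "b \<subseteq> c"
    then show "c \<in> U" using U_up by blast
  qed (use U_sub U_empty U_Int in blast)+
  show "U \<inter> blocks A = P"
  proof (intro equalityI subsetI)
    fix S assume S: "S \<in> U \<inter> blocks A"
    then obtain S' T where *: "S' \<in> P" "T \<in> blocks A" "T \<notin> P" "S' \<subseteq> S \<union> T"
      unfolding U_def by blast
    then have "S \<union> T \<in> P" using S P'(5) A'(5) by blast
    then show "S \<in> P" using S * P'(6) by blast
  next
    fix S assume "S \<in> P"
    then show "S \<in> U \<inter> blocks A"
      using in_U[of S S "{}"] P'(1,3) A'(2) blocks_symmetrization[of S A] by auto
  qed
qed

lemma prime_filters_fixed_symmetrization: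
  assumes A: "pervin_space A"
  shows "prime_filters_fixed (symmetrization A) \<longleftrightarrow> prime_filters_fixed A"
proof -
  have pA: "pervin_space (symmetrization A)"
    using symmetric_pervin_symmetrization[OF A] by (simp add: symmetric_pervin_def)
  have pt: "point_filter (symmetrization A) x \<inter> blocks A = point_filter A x" for x
    using blocks_symmetrization[of _ A] by (auto simp: point_filter_def)
  show ?thesis
    unfolding prime_filters_fixed_def
  proof (intro iffI allI impI)
    fix P assume *: "\<forall>U. prime_filter (symmetrization A) U \<longrightarrow>
        (\<exists>x\<in>points (symmetrization A). U = point_filter (symmetrization A) x)" "prime_filter A P"
    then show "\<exists>x\<in>points A. P = point_filter A x"
      using prime_filter_extend[OF A *(2)] pt by (metis symmetrization_sel(1))
  next
    fix U assume *: "\<forall>P. prime_filter A P \<longrightarrow> (\<exists>x\<in>points A. P = point_filter A x)"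
      "prime_filter (symmetrization A) U"
    then obtain x where x: "x \<in> points A" "U \<inter> blocks A = point_filter A x"
      using prime_filter_restrict[OF A] by blast
    have "U = point_filter (symmetrization A) x"
      using prime_filter_symmetrization_determined[OF A *(2) prime_filter_point_filter[OF pA]] x pt
      by simp
    then show "\<exists>x\<in>points (symmetrization A). U = point_filter (symmetrization A) x"
      using x(1) by auto
  qed
qed

lemma pervin_T0_symmetrization:
  assumes "pervin_space A" "pervin_T0 A"
  shows "pervin_T0 (symmetrization A)"
proof -
  have pA: "pervin_space (symmetrization A)"
    using symmetric_pervin_symmetrization[OF assms(1)] by (simp add: symmetric_pervin_def)
  show ?thesis
    unfolding pervin_T0_iff[OF pA]
  proof (intro ballI impI)
    fix x y assume "x \<in> points (symmetrization A)" "y \<in> points (symmetrization A)" "x \<noteq> y"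
    then obtain S where "S \<in> blocks A" "(x \<in> S) \<noteq> (y \<in> S)"
      using assms(2) unfolding pervin_T0_iff[OF assms(1)] by auto
    then show "\<exists>S\<in>blocks (symmetrization A). (x \<in> S) \<noteq> (y \<in> S)"
      using blocks_symmetrization by blast
  qed
qed

section \<open>Completeness means that prime filters are fixed\<close>

text \<open>Density makes taking traces on \<open>A\<close> an isomorphism between the Boolean algebras of blocks. The
  traces of the blocks around a point \<open>y\<close> of the extension are therefore a prime filter of \<open>A\<close>. If
  \<open>x\<close> fixes it, then \<open>f x\<close> and \<open>y\<close> lie in the same blocks, and \<open>T\<^sub>0\<close> gives \<open>f x = y\<close>; so the embedding
  is onto.\<close>

lemma fixed_imp_symmetric_complete_in:
  fixes A :: "'a pervin"
  assumes A: "symmetric_pervin A" and fixed: "prime_filters_fixed A"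
  shows "symmetric_complete_in TYPE('b) A"
  unfolding symmetric_complete_in_def
proof (intro conjI allI impI)
  fix B :: "'b pervin" and f
  assume "symmetric_pervin B \<and> pervin_T0 B \<and> dense_map A B f \<and> extremal_mono A B f"
  then have B: "symmetric_pervin B" "pervin_T0 B" "dense_map A B f" "extremal_mono A B f"
    by auto
  then have pB: "pervin_space B" by (simp add: symmetric_pervin_def)
  note B' = pervin_spaceD[OF pB]
  have f: "f \<in> points A \<rightarrow>\<^sub>E points B" "\<And>T. T \<in> blocks B \<Longrightarrow> f -` T \<inter> points A \<in> blocks A"
    "inj_on f (points A)" "\<And>S. S \<in> blocks A \<Longrightarrow> \<exists>T\<in>blocks B. S = f -` T \<inter> points A"
    using B(4) by (auto simp: extremal_mono_def pervin_hom_def)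
  have f_in: "f x \<in> points B" if "x \<in> points A" for x using f(1) that by auto
  \<comment> \<open>the difference of the two blocks is a block that misses the dense image\<close>
  have mono: "T \<subseteq> T'"
    if T: "T \<in> blocks B" "T' \<in> blocks B" "f -` T \<inter> points A \<subseteq> f -` T'" for T T'
  proof -
    have "T \<inter> (points B - T') \<in> blocks B" using T symmetric_compl[OF B(1)] B'(4) by blast
    moreover have "T \<inter> (points B - T') \<inter> f ` points A = {}" using T(3) by auto
    ultimately have "T \<inter> (points B - T') = {}"
      using B(3)[unfolded dense_map_iff[OF pB], rule_format] by metis
    then show ?thesis using B'(1)[OF T(1)] by auto
  qed
  have surj: "\<exists>x\<in>points A. f x = y" if y: "y \<in> points B" for y
  proof -
    define U where "U = {f -` T \<inter> points A |T. T \<in> blocks B \<and> y \<in> T}"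
    have mem: "f -` T \<inter> points A \<in> U \<longleftrightarrow> y \<in> T" if T: "T \<in> blocks B" for T
    proof
      assume "f -` T \<inter> points A \<in> U"
      then obtain T' where "T' \<in> blocks B" "y \<in> T'" "f -` T \<inter> points A = f -` T' \<inter> points A"
        by (auto simp: U_def)
      then show "y \<in> T" using mono[of T' T] T by auto
    qed (use T in \<open>auto simp: U_def\<close>)
    have U: "prime_filter A U"
      unfolding prime_filter_def
    proof (intro conjI ballI impI)
      show "U \<subseteq> blocks A" using f(2) by (auto simp: U_def)
      have "f -` points B \<inter> points A = points A" using f_in by auto
      then show "points A \<in> U" using mem[OF B'(3)] y by simp
      show "{} \<notin> U" using mem[OF B'(2)] by simp
    next
      fix S S' assume "S \<in> U" "S' \<in> U"
      then obtain T T' where T: "T \<in> blocks B" "y \<in> T" "S = f -` T \<inter> points A"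
        "T' \<in> blocks B" "y \<in> T'" "S' = f -` T' \<inter> points A" by (auto simp: U_def)
      then have "S \<inter> S' = f -` (T \<inter> T') \<inter> points A" by auto
      then show "S \<inter> S' \<in> U" using mem[OF B'(4)] T by simp
    next
      fix S S' assume "S \<in> U" "S' \<in> blocks A" "S \<subseteq> S'"
      then obtain T T' where T: "T \<in> blocks B" "y \<in> T" "S = f -` T \<inter> points A"
        "T' \<in> blocks B" "S' = f -` T' \<inter> points A" using f(4)[of S'] unfolding U_def by blast
      then show "S' \<in> U" using mono[of T T'] mem[of T'] \<open>S \<subseteq> S'\<close> by blast
    next
      fix S S' assume "S \<in> blocks A" "S' \<in> blocks A" and un: "S \<union> S' \<in> U"
      then obtain T T' where T: "T \<in> blocks B" "S = f -` T \<inter> points A"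
        "T' \<in> blocks B" "S' = f -` T' \<inter> points A" using f(4) by metis
      then have "S \<union> S' = f -` (T \<union> T') \<inter> points A" by auto
      then show "S \<in> U \<or> S' \<in> U" using un mem[OF B'(5)] mem T by simp
    qed
    then obtain x where x: "x \<in> points A" "U = point_filter A x"
      using fixed by (auto simp: prime_filters_fixed_def)
    have "f x \<in> T \<longleftrightarrow> y \<in> T" if "T \<in> blocks B" for T
      using mem[OF that] x f(2)[OF that] by (auto simp: point_filter_def)
    then have "f x = y" using B(2) f_in[OF x(1)] y unfolding pervin_T0_iff[OF pB] by blast
    then show ?thesis using x(1) by blast
  qed
  define g where "g = (\<lambda>y\<in>points B. the_inv_into (points A) f y)"
  have gf: "g (f x) = x" if "x \<in> points A" for x
    using that f_in f(3) by (simp add: g_def the_inv_into_f_f)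
  have fg: "g y \<in> points A" "f (g y) = y" if "y \<in> points B" for y
    using surj[OF that] gf by auto
  have "g \<in> pervin_hom B A"
    unfolding pervin_hom_def
  proof (intro CollectI conjI ballI)
    show "g \<in> points B \<rightarrow>\<^sub>E points A" using fg by (auto simp: g_def)
    fix S assume "S \<in> blocks A"
    then obtain T where T: "T \<in> blocks B" "S = f -` T \<inter> points A" using f(4) by blast
    then have "g -` S \<inter> points B = T" using fg B'(1)[OF T(1)] by auto
    then show "g -` S \<inter> points B \<in> blocks B" using T by simp
  qed
  moreover have "compose (points A) g f = (\<lambda>x\<in>points A. x)"
    "compose (points B) f g = (\<lambda>y\<in>points B. y)"
    using gf fg by (auto simp: compose_def)
  ultimately show "pervin_iso A B f"
    using B(4) unfolding pervin_iso_def extremal_mono_def by blast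
qed (rule A)

text \<open>The prime filters of the points, together with the given prime filter \<open>U\<close>, form a dense extension
  of \<open>A\<close> in the manner of the Stone space. Completeness makes its embedding onto, so \<open>U\<close> is the
  filter of a point. As the points of the extension are sets of blocks, it is a space over
  \<^typ>\<open>'a set set\<close>.\<close>

lemma symmetric_complete_imp_fixed:
  fixes A :: "'a pervin"
  assumes T0: "pervin_T0 A" and complete: "symmetric_complete A"
  shows "prime_filters_fixed A"
  unfolding prime_filters_fixed_def
proof (intro allI impI)
  fix U assume U: "prime_filter A U"
  have sA: "symmetric_pervin A"
    using complete by (simp add: symmetric_complete_def symmetric_complete_in_def)
  then have pA: "pervin_space A" by (simp add: symmetric_pervin_def)
  note A' = pervin_spaceD[OF pA]
  define Y where "Y = insert U (point_filter A ` points A)"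
  \<comment> \<open>the clopen set of the Stone space that corresponds to the block \<open>b\<close>\<close>
  define D where "D b = {V \<in> Y. b \<in> V}" for b
  define B where "B = \<lparr>points = Y, blocks = D ` blocks A\<rparr>"
  have B_sel [simp]: "points B = Y" "blocks B = D ` blocks A" by (simp_all add: B_def)
  have Y: "prime_filter A V" if "V \<in> Y" for V
    using that U prime_filter_point_filter[OF pA] by (auto simp: Y_def)
  have D_empty: "D {} = {}" and D_points: "D (points A) = Y"
    using prime_filterD(2,3)[OF Y] by (auto simp: D_def)
  have D_Un: "D (b \<union> c) = D b \<union> D c" if "b \<in> blocks A" "c \<in> blocks A" for b c
    using prime_filter_Un_iff[OF pA Y that] by (auto simp: D_def)
  have D_compl: "D (points A - b) = Y - D b" if "b \<in> blocks A" for b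
    using prime_filter_compl_iff[OF sA Y that] by (auto simp: D_def)
  have alg: "algebra Y (D ` blocks A)"
    unfolding algebra_iff_Un
  proof (intro conjI ballI)
    show "D ` blocks A \<subseteq> Pow Y" by (auto simp: D_def)
    show "{} \<in> D ` blocks A" using A'(2) D_empty by (metis imageI)
  next
    fix a assume "a \<in> D ` blocks A"
    then obtain b where b: "b \<in> blocks A" "a = D b" by blast
    then have "Y - a = D (points A - b)" using D_compl by simp
    then show "Y - a \<in> D ` blocks A" using symmetric_compl[OF sA b(1)] by simp
  next
    fix a a' assume "a \<in> D ` blocks A" "a' \<in> D ` blocks A"
    then obtain b b' where b: "b \<in> blocks A" "a = D b" "b' \<in> blocks A" "a' = D b'" by blast
    then have "a \<union> a' = D (b \<union> b')" using D_Un by simp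
    then show "a \<union> a' \<in> D ` blocks A" using A'(5)[OF b(1,3)] by simp
  qed
  then interpret D: algebra Y "D ` blocks A" .
  have pB: "pervin_space B"
    using D.space_closed D.empty_sets D.top D.Int D.Un by (simp add: pervin_space_def)
  then have sB: "symmetric_pervin B" using alg by (simp add: symmetric_pervin_def)
  have tB: "pervin_T0 B"
    unfolding pervin_T0_iff[OF pB]
  proof (intro ballI impI)
    fix V W assume VW: "V \<in> points B" "W \<in> points B" "V \<noteq> W"
    then obtain b where "(b \<in> V) \<noteq> (b \<in> W)" by blast
    moreover from this have "b \<in> blocks A" using VW prime_filterD(1)[OF Y] by auto
    ultimately show "\<exists>S\<in>blocks B. (V \<in> S) \<noteq> (W \<in> S)" using VW by (auto simp: D_def)
  qed
  define f where "f = (\<lambda>x\<in>points A. point_filter A x)"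
  have pre: "f -` D b \<inter> points A = b" if "b \<in> blocks A" for b
    using that A'(1)[OF that] by (auto simp: f_def D_def Y_def point_filter_def)
  have "dense_map A B f"
    unfolding dense_map_iff[OF pB]
  proof (intro ballI impI)
    fix T assume "T \<in> blocks B" "T \<noteq> {}"
    then obtain b where b: "b \<in> blocks A" "T = D b" by auto
    then have "b \<noteq> {}" using \<open>T \<noteq> {}\<close> D_empty by auto
    then show "T \<inter> f ` points A \<noteq> {}" using pre[OF b(1)] b(2) by blast
  qed
  moreover have "inj_on f (points A)"
  proof (rule inj_onI, rule ccontr)
    fix x y assume xy: "x \<in> points A" "y \<in> points A" "f x = f y" "x \<noteq> y"
    then obtain S where "S \<in> blocks A" "(x \<in> S) \<noteq> (y \<in> S)"
      using T0 unfolding pervin_T0_iff[OF pA] by blast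
    then show False using xy by (auto simp: f_def point_filter_def)
  qed
  then have "extremal_mono A B f"
    unfolding extremal_mono_def pervin_hom_def using pre by (auto simp: f_def Y_def)
  ultimately have "pervin_iso A B f"
    using complete sB tB by (auto simp: symmetric_complete_def symmetric_complete_in_def)
  then obtain g where g: "g \<in> pervin_hom B A" "compose (points B) f g = (\<lambda>y\<in>points B. y)"
    by (auto simp: pervin_iso_def)
  have UY: "U \<in> Y" by (simp add: Y_def)
  then have "g U \<in> points A" using g(1) by (auto simp: pervin_hom_def)
  moreover have "f (g U) = U" using fun_cong[OF g(2), of U] UY by (simp add: compose_def)
  ultimately show "\<exists>x\<in>points A. U = point_filter A x" by (auto simp: f_def)
qed

theorem complete_pervin_iff_prime_filters_fixed:
  assumes "pervin_space A" "pervin_T0 A"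
  shows "complete_pervin A \<longleftrightarrow> prime_filters_fixed A"
  using symmetric_complete_imp_fixed[OF pervin_T0_symmetrization[OF assms]]
    fixed_imp_symmetric_complete_in[OF symmetric_pervin_symmetrization[OF assms(1)]]
    prime_filters_fixed_symmetrization[OF assms(1)] assms(1)
  by (auto simp: complete_pervin_def symmetric_complete_def)

section \<open>Compactness of the blocks\<close>

definition set_lattice :: "'b set set \<Rightarrow> 'b set gorder" where
  "set_lattice C = \<lparr>carrier = C, eq = (=), le = (\<subseteq>)\<rparr>"

lemma set_lattice_sel [simp]:
  "carrier (set_lattice C) = C" "eq (set_lattice C) = (=)" "le (set_lattice C) = (\<subseteq>)"
  by (simp_all add: set_lattice_def)

lemma set_lattice_join:
  assumes "x \<in> C" "y \<in> C" "x \<union> y \<in> C"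
  shows "least (set_lattice C) (x \<union> y) (Upper (set_lattice C) {x, y})"
    and "x \<squnion>\<^bsub>set_lattice C\<^esub> y = x \<union> y"
proof -
  show 1: "least (set_lattice C) (x \<union> y) (Upper (set_lattice C) {x, y})"
    using assms by (auto simp: least_def Upper_def)
  show "x \<squnion>\<^bsub>set_lattice C\<^esub> y = x \<union> y"
    unfolding join_def sup_def
    by (rule some_equality, rule 1) (use 1 in \<open>auto simp: least_def\<close>)
qed

lemma set_lattice_meet:
  assumes "x \<in> C" "y \<in> C" "x \<inter> y \<in> C"
  shows "greatest (set_lattice C) (x \<inter> y) (Lower (set_lattice C) {x, y})"
    and "x \<sqinter>\<^bsub>set_lattice C\<^esub> y = x \<inter> y"
proof -
  show 1: "greatest (set_lattice C) (x \<inter> y) (Lower (set_lattice C) {x, y})"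
    using assms by (auto simp: greatest_def Lower_def)
  show "x \<sqinter>\<^bsub>set_lattice C\<^esub> y = x \<inter> y"
    unfolding meet_def inf_def
    by (rule some_equality, rule 1) (use 1 in \<open>auto simp: greatest_def\<close>)
qed

lemma distributive_set_lattice:
  assumes "{} \<in> C" "S \<in> C" "\<And>x. x \<in> C \<Longrightarrow> x \<subseteq> S"
    and "\<And>x y. x \<in> C \<Longrightarrow> y \<in> C \<Longrightarrow> x \<inter> y \<in> C"
    and "\<And>x y. x \<in> C \<Longrightarrow> y \<in> C \<Longrightarrow> x \<union> y \<in> C"
  shows "distributive_lattice (set_lattice C)"
proof -
  have "bounded_lattice (set_lattice C)"
  proof
    show "\<exists>x. least (set_lattice C) x (carrier (set_lattice C))"
      using assms(1) by (auto simp: least_def)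
    show "\<exists>x. greatest (set_lattice C) x (carrier (set_lattice C))"
      using assms(2,3) by (auto simp: greatest_def)
  next
    fix x y assume "x \<in> carrier (set_lattice C)" "y \<in> carrier (set_lattice C)"
    then show "\<exists>s. least (set_lattice C) s (Upper (set_lattice C) {x, y})"
      "\<exists>s. greatest (set_lattice C) s (Lower (set_lattice C) {x, y})"
      using set_lattice_join(1)[of x C y] set_lattice_meet(1)[of x C y] assms(4,5) by auto
  qed auto
  then show ?thesis
    by (auto simp: distributive_lattice_def set_lattice_join(2) set_lattice_meet(2) assms(4,5))
qed

text \<open>The Prime Ideal Theorem only keeps an ideal away from the top element. In the lattice of the blocks
  below \<open>S\<close> the top is \<open>S\<close> itself; a prime ideal there is pulled back to all blocks along
  \<open>T \<mapsto> T \<inter> S\<close>, a lattice homomorphism, and its complement is the filter sought.\<close>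

lemma prime_filter_separating:
  fixes A :: "'a pervin"
  assumes PIT: "prime_ideal_theorem TYPE('a set)" and A: "pervin_space A" and S: "S \<in> blocks A"
    and I: "I \<subseteq> blocks A" "{} \<in> I" "S \<notin> I"
      "\<And>T T'. T \<in> I \<Longrightarrow> T' \<in> blocks A \<Longrightarrow> T' \<subseteq> T \<Longrightarrow> T' \<in> I"
      "\<And>T T'. T \<in> I \<Longrightarrow> T' \<in> I \<Longrightarrow> T \<union> T' \<in> I"
  obtains P where "prime_filter A P" "S \<in> P" "P \<inter> I = {}"
proof -
  note A' = pervin_spaceD[OF A]
  define C where "C = {T \<in> blocks A. T \<subseteq> S}"
  have Int: "x \<inter> y \<in> C" and Un: "x \<union> y \<in> C" if "x \<in> C" "y \<in> C" for x y
    using that A'(4,5) by (auto simp: C_def)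
  have C: "{} \<in> C" "S \<in> C" "\<And>x. x \<in> C \<Longrightarrow> x \<subseteq> S" using A'(2) S by (auto simp: C_def)
  have "distributive_lattice (set_lattice C)"
    by (rule distributive_set_lattice[OF C Int Un])
  moreover have "proper_ideal (set_lattice C) (I \<inter> C)"
    unfolding proper_ideal_def lattice_ideal_def
  proof (intro conjI ballI impI)
    show "I \<inter> C \<noteq> {}" using I(2) C(1) by blast
    show "I \<inter> C \<noteq> carrier (set_lattice C)" using I(3) C(2) by auto
    fix x assume x: "x \<in> I \<inter> C"
    show "y \<in> I \<inter> C" if "y \<in> carrier (set_lattice C)" "y \<sqsubseteq>\<^bsub>set_lattice C\<^esub> x" for y
      using x that I(4)[of x y] by (simp add: C_def)
    show "x \<squnion>\<^bsub>set_lattice C\<^esub> y \<in> I \<inter> C" if "y \<in> I \<inter> C" for y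
      using x that I(5)[of x y] Un[of x y] set_lattice_join(2)[of x C y] by simp
  qed simp
  ultimately have "\<exists>Q. prime_ideal (set_lattice C) Q \<and> I \<inter> C \<subseteq> Q"
    using PIT[unfolded prime_ideal_theorem_def, rule_format, of "set_lattice C" "I \<inter> C"] by simp
  then obtain Q where Q: "prime_ideal (set_lattice C) Q" "I \<inter> C \<subseteq> Q" by blast
  have Q_sub: "Q \<subseteq> C" and Q_down: "\<And>x y. x \<in> Q \<Longrightarrow> y \<in> C \<Longrightarrow> y \<subseteq> x \<Longrightarrow> y \<in> Q"
    and Q_ne: "Q \<noteq> C"
    using Q(1) by (auto simp: prime_ideal_def proper_ideal_def lattice_ideal_def)
  have Q_Un: "x \<union> y \<in> Q" if "x \<in> Q" "y \<in> Q" for x y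
  proof -
    have "x \<squnion>\<^bsub>set_lattice C\<^esub> y \<in> Q"
      using Q(1) that by (auto simp: prime_ideal_def proper_ideal_def lattice_ideal_def)
    moreover have "x \<in> C" "y \<in> C" using that Q_sub by auto
    ultimately show ?thesis using set_lattice_join(2)[OF _ _ Un] by simp
  qed
  have Q_prime: "x \<in> Q \<or> y \<in> Q" if "x \<in> C" "y \<in> C" "x \<inter> y \<in> Q" for x y
    using Q(1) that set_lattice_meet(2)[OF that(1,2) Int[OF that(1,2)]]
    by (auto simp: prime_ideal_def)
  have S_Q: "S \<notin> Q" using Q_down[of S] C(3) Q_sub Q_ne by blast
  have empty_Q: "{} \<in> Q" using Q(2) I(2) C(1) by blast
  have trace: "T \<inter> S \<in> C" if "T \<in> blocks A" for T using that A'(4) S by (auto simp: C_def)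
  define P where "P = {T \<in> blocks A. T \<inter> S \<notin> Q}"
  have "prime_filter A P"
    unfolding prime_filter_def
  proof (intro conjI ballI impI)
    have "points A \<inter> S = S" using A'(1)[OF S] by auto
    then show "points A \<in> P" using A'(3) S_Q by (simp add: P_def)
    show "{} \<notin> P" using empty_Q by (simp add: P_def)
  next
    fix T T' assume TT: "T \<in> P" "T' \<in> P"
    then have "(T \<inter> S) \<inter> (T' \<inter> S) \<notin> Q" using Q_prime trace by (auto simp: P_def)
    moreover have "(T \<inter> S) \<inter> (T' \<inter> S) = (T \<inter> T') \<inter> S" by auto
    ultimately show "T \<inter> T' \<in> P" using TT A'(4) by (auto simp: P_def)
  next
    fix T T' assume "T \<in> P" "T' \<in> blocks A" "T \<subseteq> T'"
    then show "T' \<in> P" using Q_down[of "T' \<inter> S" "T \<inter> S"] trace by (auto simp: P_def)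
  next
    fix T T' assume "T \<in> blocks A" "T' \<in> blocks A" "T \<union> T' \<in> P"
    then show "T \<in> P \<or> T' \<in> P" using Q_Un by (auto simp: P_def Int_Un_distrib2)
  qed (auto simp: P_def)
  moreover have "S \<in> P" using S S_Q by (simp add: P_def)
  moreover have "P \<inter> I = {}"
  proof -
    have "T \<inter> S \<in> Q" if "T \<in> I" for T
      using that I(1) I(4)[OF that, of "T \<inter> S"] trace Q(2) by (auto simp: C_def)
    then show ?thesis by (auto simp: P_def)
  qed
  ultimately show ?thesis by (rule that)
qed

lemma openin_block:
  "S \<in> blocks A \<Longrightarrow> openin (pervin_topology A) S"
  by (simp add: pervin_topology_def topology_generated_by_Basis)

lemma block_neighbourhood:
  assumes "pervin_space A" "openin (pervin_topology A) U" "x \<in> U"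
  obtains S where "S \<in> blocks A" "x \<in> S" "S \<subseteq> U"
proof -
  obtain \<K> where "\<K> \<subseteq> blocks A" "U = \<Union>\<K>"
    using assms(2) unfolding openin_pervin_topology[OF assms(1)] by blast
  then show ?thesis using assms(3) that by blast
qed

text \<open>A point that fixes a prime filter containing \<open>S\<close> and avoiding all blocks with a finite subcover
  lies in \<open>S\<close>, but every block around it inside a member of the cover has a subcover of size one.\<close>

lemma compactin_blocks:
  fixes A :: "'a pervin"
  assumes PIT: "prime_ideal_theorem TYPE('a set)" and A: "pervin_space A"
    and fixed: "prime_filters_fixed A" and S: "S \<in> blocks A"
  shows "compactin (pervin_topology A) S"
  unfolding compactin_def
proof (intro conjI allI impI)
  note A' = pervin_spaceD[OF A]
  show "S \<subseteq> topspace (pervin_topology A)" using A'(1)[OF S] topspace_pervin_topology[OF A] by simp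
  fix \<U> assume \<U>: "(\<forall>U\<in>\<U>. openin (pervin_topology A) U) \<and> S \<subseteq> \<Union>\<U>"
  define I where "I = {T \<in> blocks A. \<exists>\<F>. finite \<F> \<and> \<F> \<subseteq> \<U> \<and> T \<subseteq> \<Union>\<F>}"
  have "S \<in> I"
  proof (rule ccontr)
    assume nS: "S \<notin> I"
    have "{} \<in> I" using A'(2) by (auto simp: I_def)
    have down: "\<And>T T'. T \<in> I \<Longrightarrow> T' \<in> blocks A \<Longrightarrow> T' \<subseteq> T \<Longrightarrow> T' \<in> I"
      unfolding I_def by blast
    have un: "T \<union> T' \<in> I" if TT: "T \<in> I" "T' \<in> I" for T T'
    proof -
      obtain \<F> \<F>' where "finite \<F>" "\<F> \<subseteq> \<U>" "T \<subseteq> \<Union>\<F>" "finite \<F>'" "\<F>' \<subseteq> \<U>" "T' \<subseteq> \<Union>\<F>'"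
        using TT by (auto simp: I_def)
      then have "finite (\<F> \<union> \<F>')" "\<F> \<union> \<F>' \<subseteq> \<U>" "T \<union> T' \<subseteq> \<Union>(\<F> \<union> \<F>')" by auto
      then show ?thesis using TT A'(5) unfolding I_def by blast
    qed
    have "I \<subseteq> blocks A" by (auto simp: I_def)
    obtain P where P: "prime_filter A P" "S \<in> P" "P \<inter> I = {}"
      by (rule prime_filter_separating[OF PIT A S \<open>I \<subseteq> blocks A\<close> \<open>{} \<in> I\<close> nS])
        (use down un in blast)+
    then obtain x where x: "x \<in> points A" "P = point_filter A x"
      using fixed by (auto simp: prime_filters_fixed_def)
    then have "x \<in> S" using P(2) by (simp add: point_filter_def)
    then obtain U where U: "U \<in> \<U>" "x \<in> U" using \<U> by blast
    then obtain T where T: "T \<in> blocks A" "x \<in> T" "T \<subseteq> U"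
      using \<U> block_neighbourhood[OF A, of U x] by blast
    have "finite {U} \<and> {U} \<subseteq> \<U> \<and> T \<subseteq> \<Union>{U}" using U T by simp
    then have "T \<in> I" using T(1) unfolding I_def by blast
    moreover have "T \<in> P" using T x(2) by (simp add: point_filter_def)
    ultimately show False using P(3) by blast
  qed
  then show "\<exists>\<F>. finite \<F> \<and> \<F> \<subseteq> \<U> \<and> S \<subseteq> \<Union>\<F>" by (simp add: I_def)
qed

text \<open>A compact open set is a union of blocks, by compactness a finite one, and blocks are closed under
  finite unions.\<close>

lemma compact_opens_pervin_topology:
  fixes A :: "'a pervin"
  assumes PIT: "prime_ideal_theorem TYPE('a set)" and A: "pervin_space A"
    and fixed: "prime_filters_fixed A"
  shows "compact_opens (pervin_topology A) = blocks A"
proof (intro equalityI subsetI)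
  fix K assume "K \<in> compact_opens (pervin_topology A)"
  then have K: "openin (pervin_topology A) K" "compactin (pervin_topology A) K"
    by (auto simp: compact_opens_def)
  then obtain \<K> where \<K>: "\<K> \<subseteq> blocks A" "K = \<Union>\<K>" using openin_pervin_topology[OF A] by blast
  obtain \<F> where \<F>: "finite \<F>" "\<F> \<subseteq> \<K>" "K \<subseteq> \<Union>\<F>"
    using compactinD[OF K(2), of \<K>] openin_block \<K> by (metis subset_iff subset_refl)
  then have "K = \<Union>\<F>" using \<K> by blast
  then show "K \<in> blocks A" using finite_Union_blocks[OF A \<F>(1)] \<F>(2) \<K>(1) by auto
next
  fix S assume "S \<in> blocks A"
  then show "S \<in> compact_opens (pervin_topology A)"
    using compactin_blocks[OF PIT A fixed]
    by (simp add: compact_opens_def openin_block)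
qed

section \<open>Sobriety\<close>

lemma in_closure_of_singleton_pervin:
  assumes A: "pervin_space A"
  shows "z \<in> pervin_topology A closure_of {x} \<longleftrightarrow>
    z \<in> points A \<and> (\<forall>S\<in>blocks A. z \<in> S \<longrightarrow> x \<in> S)"
proof -
  have "(\<forall>U. z \<in> U \<and> openin (pervin_topology A) U \<longrightarrow> x \<in> U) \<longleftrightarrow> (\<forall>S\<in>blocks A. z \<in> S \<longrightarrow> x \<in> S)"
  proof (intro iffI allI ballI impI)
    fix U assume *: "\<forall>S\<in>blocks A. z \<in> S \<longrightarrow> x \<in> S" and "z \<in> U \<and> openin (pervin_topology A) U"
    then obtain S where "S \<in> blocks A" "z \<in> S" "S \<subseteq> U" using block_neighbourhood[OF A] by metis
    then show "x \<in> U" using * by blast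
  qed (use openin_block in blast)
  then show ?thesis by (simp add: in_closure_of topspace_pervin_topology[OF A])
qed

text \<open>Irreducibility of \<open>C\<close> says that two open sets meeting \<open>C\<close> meet within \<open>C\<close>, so the blocks that meet
  \<open>C\<close> are a prime filter; the point that fixes it lies in the same blocks as a generic point must.\<close>

lemma sober_pervin_topology:
  assumes A: "pervin_space A" and T0: "pervin_T0 A" and fixed: "prime_filters_fixed A"
  shows "sober_space (pervin_topology A)"
  unfolding sober_space_def
proof (intro allI impI)
  note A' = pervin_spaceD[OF A]
  let ?X = "pervin_topology A"
  note top = topspace_pervin_topology[OF A]
  fix C assume "irreducible_closed ?X C"
  then have C: "closedin ?X C" "C \<noteq> {}"
    "\<And>D E. closedin ?X D \<Longrightarrow> closedin ?X E \<Longrightarrow> C = D \<union> E \<Longrightarrow> C = D \<or> C = E"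
    by (auto simp: irreducible_closed_def)
  have C_sub: "C \<subseteq> points A" using closedin_subset[OF C(1)] top by simp
  define P where "P = {S \<in> blocks A. S \<inter> C \<noteq> {}}"
  have "prime_filter A P"
    unfolding prime_filter_def
  proof (intro conjI ballI impI)
    show "points A \<in> P" using A'(3) C(2) C_sub by (auto simp: P_def)
  next
    fix S T assume ST: "S \<in> P" "T \<in> P"
    have "S \<inter> T \<inter> C \<noteq> {}"
    proof
      assume "S \<inter> T \<inter> C = {}"
      then have "C = (C - S) \<union> (C - T)" by blast
      moreover have "closedin ?X (C - S)" "closedin ?X (C - T)"
        using ST C(1) by (auto simp: P_def intro: closedin_diff openin_block)
      ultimately have "C = C - S \<or> C = C - T" using C(3) by blast
      then show False using ST by (auto simp: P_def)
    qed
    then show "S \<inter> T \<in> P" using ST A'(4) by (auto simp: P_def)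
  qed (auto simp: P_def)
  then obtain x where x: "x \<in> points A" "P = point_filter A x"
    using fixed by (auto simp: prime_filters_fixed_def)
  have meet: "S \<inter> C \<noteq> {} \<longleftrightarrow> x \<in> S" if "S \<in> blocks A" for S
    using x(2) that by (auto simp: P_def point_filter_def)
  have "x \<in> C"
  proof (rule ccontr)
    assume "x \<notin> C"
    then have "x \<in> points A - C" using x(1) by simp
    moreover have "openin ?X (points A - C)" using C(1) top by (metis closedin_def)
    ultimately obtain S where "S \<in> blocks A" "x \<in> S" "S \<subseteq> points A - C"
      using block_neighbourhood[OF A] by metis
    then show False using meet by blast
  qed
  have "C = ?X closure_of {x}"
  proof
    show "?X closure_of {x} \<subseteq> C" using \<open>x \<in> C\<close> C(1) by (simp add: closure_of_minimal)
    show "C \<subseteq> ?X closure_of {x}"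
    proof
      fix z assume "z \<in> C"
      then have "z \<in> points A" "\<And>S. S \<in> blocks A \<Longrightarrow> z \<in> S \<Longrightarrow> x \<in> S"
        using C_sub meet by blast+
      then show "z \<in> ?X closure_of {x}" by (simp add: in_closure_of_singleton_pervin[OF A])
    qed
  qed
  moreover have "y = z"
    if yz: "y \<in> points A" "z \<in> points A" "?X closure_of {y} = ?X closure_of {z}" for y z
  proof (rule ccontr)
    assume "y \<noteq> z"
    then obtain S where "S \<in> blocks A" "(y \<in> S) \<noteq> (z \<in> S)"
      using T0 yz(1,2) unfolding pervin_T0_iff[OF A] by blast
    moreover have "y \<in> ?X closure_of {y}" "z \<in> ?X closure_of {z}"
      using yz(1,2) by (simp_all add: in_closure_of_singleton_pervin[OF A])
    then have "y \<in> ?X closure_of {z}" "z \<in> ?X closure_of {y}"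
      using yz(3) by simp_all
    ultimately show False by (auto simp: in_closure_of_singleton_pervin[OF A])
  qed
  ultimately show "\<exists>!x. x \<in> topspace ?X \<and> C = ?X closure_of {x}" using x(1) top by auto
qed

lemma spectral_pervin_topology:
  fixes A :: "'a pervin"
  assumes PIT: "prime_ideal_theorem TYPE('a set)" and A: "pervin_space A"
    and T0: "pervin_T0 A" and fixed: "prime_filters_fixed A"
  shows "spectral_space (pervin_topology A)"
  unfolding spectral_space_def compact_opens_pervin_topology[OF PIT A fixed]
    topspace_pervin_topology[OF A] openin_pervin_topology[OF A]
proof (intro conjI allI impI)
  fix \<F> assume "finite \<F> \<and> \<F> \<subseteq> blocks A"
  then have "finite \<F>" "\<F> \<subseteq> blocks A" by auto
  then show "points A \<inter> \<Inter>\<F> \<in> blocks A"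
  proof (induction \<F>)
    case (insert S \<F>)
    then have "S \<inter> (points A \<inter> \<Inter>\<F>) \<in> blocks A" using pervin_spaceD(4)[OF A] by auto
    then show ?case by (simp add: Int_left_commute)
  qed (simp add: pervin_spaceD(3)[OF A])
qed (use sober_pervin_topology[OF A T0 fixed] in auto)

section \<open>Spectral spaces as Pervin spaces\<close>

definition KO_space :: "'a topology \<Rightarrow> 'a pervin" where
  "KO_space X = \<lparr>points = topspace X, blocks = compact_opens X\<rparr>"

lemma KO_space_sel [simp]:
  "points (KO_space X) = topspace X" "blocks (KO_space X) = compact_opens X"
  by (simp_all add: KO_space_def)

lemma spectral_space_basis:
  assumes "spectral_space X" "openin X U"
  obtains \<K> where "\<K> \<subseteq> compact_opens X" "U = \<Union>\<K>"
proof -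
  have "\<exists>\<K>\<subseteq>compact_opens X. U = \<Union>\<K>" using assms by (simp add: spectral_space_def)
  then show ?thesis using that by blast
qed

lemma pervin_space_KO_space:
  assumes "spectral_space X"
  shows "pervin_space (KO_space X)"
proof -
  have fin: "topspace X \<inter> \<Inter>\<F> \<in> compact_opens X" if "finite \<F>" "\<F> \<subseteq> compact_opens X" for \<F>
    using assms that by (auto simp: spectral_space_def)
  have sub: "K \<subseteq> topspace X" if "K \<in> compact_opens X" for K
    using that openin_subset by (auto simp: compact_opens_def)
  have "K \<inter> L \<in> compact_opens X" if "K \<in> compact_opens X" "L \<in> compact_opens X" for K L
  proof -
    have "topspace X \<inter> \<Inter>{K, L} = K \<inter> L" using sub[OF that(1)] by auto
    then show ?thesis using fin[of "{K, L}"] that by auto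
  qed
  moreover have "K \<union> L \<in> compact_opens X" if "K \<in> compact_opens X" "L \<in> compact_opens X" for K L
    using that by (auto simp: compact_opens_def compactin_Un)
  moreover have "{} \<in> compact_opens X" by (auto simp: compact_opens_def)
  ultimately show ?thesis using fin[of "{}"] sub by (simp add: pervin_space_def subset_iff)
qed

lemma pervin_topology_KO_space:
  assumes "spectral_space X"
  shows "pervin_topology (KO_space X) = X"
  unfolding topology_eq openin_pervin_topology[OF pervin_space_KO_space[OF assms]] KO_space_sel
proof (intro allI iffI)
  fix U assume "\<exists>\<K>\<subseteq>compact_opens X. U = \<Union>\<K>"
  then show "openin X U" by (auto simp: compact_opens_def)
qed (use assms in \<open>simp add: spectral_space_def\<close>)

lemma irreducible_closed_closure_of_singleton:
  assumes "x \<in> topspace X"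
  shows "irreducible_closed X (X closure_of {x})"
  unfolding irreducible_closed_def
proof (intro conjI allI impI)
  have x: "x \<in> X closure_of {x}" using assms by (simp add: in_closure_of)
  then show "X closure_of {x} \<noteq> {}" by blast
  fix D E assume *: "closedin X D \<and> closedin X E \<and> X closure_of {x} = D \<union> E"
  then have "x \<in> D \<or> x \<in> E" using x by blast
  then have "X closure_of {x} \<subseteq> D \<or> X closure_of {x} \<subseteq> E"
    using * closure_of_minimal[of "{x}" D X] closure_of_minimal[of "{x}" E X] by blast
  then show "X closure_of {x} = D \<or> X closure_of {x} = E" using * by blast
qed simp

text \<open>Two points with the same neighbourhoods would be generic points of the same irreducible closed
  set.\<close>

lemma pervin_T0_KO_space:
  assumes X: "spectral_space X"
  shows "pervin_T0 (KO_space X)"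
  unfolding pervin_T0_def pervin_topology_KO_space[OF X] t0_space_def
proof (intro ballI impI, rule ccontr)
  fix x y assume xy: "x \<in> topspace X" "y \<in> topspace X" "x \<noteq> y"
    and "\<nexists>U. openin X U \<and> (x \<notin> U) = (y \<in> U)"
  then have "X closure_of {x} = X closure_of {y}" by (auto simp: set_eq_iff in_closure_of)
  moreover have "\<exists>!z. z \<in> topspace X \<and> X closure_of {x} = X closure_of {z}"
    using X irreducible_closed_closure_of_singleton[OF xy(1)]
    by (auto simp: spectral_space_def sober_space_def)
  ultimately show False using xy by blast
qed

text \<open>Remove from \<open>X\<close> all compact open sets outside \<open>P\<close>. A member of \<open>P\<close> still meets what is left:
  otherwise finitely many of the removed sets cover it, and primality puts one of them into \<open>P\<close>. So
  \<open>P\<close> consists of the compact open sets that meet the rest \<open>C\<close>. It is closed under intersection, which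
  makes \<open>C\<close> irreducible, and the generic point of \<open>C\<close> fixes \<open>P\<close>.\<close>

lemma prime_filters_fixed_KO_space:
  assumes X: "spectral_space X"
  shows "prime_filters_fixed (KO_space X)"
  unfolding prime_filters_fixed_def
proof (intro allI impI)
  fix P assume P: "prime_filter (KO_space X) P"
  have pX: "pervin_space (KO_space X)" by (rule pervin_space_KO_space[OF X])
  note P' = prime_filterD[OF P, simplified]
  define N where "N = compact_opens X - P"
  define C where "C = topspace X - \<Union>N"
  have op: "openin X K" and cp: "compactin X K" if "K \<in> compact_opens X" for K
    using that by (auto simp: compact_opens_def)
  have meet: "K \<inter> C \<noteq> {} \<longleftrightarrow> K \<in> P" if K: "K \<in> compact_opens X" for K
  proof
    assume "K \<inter> C \<noteq> {}"
    then show "K \<in> P" using K by (auto simp: C_def N_def)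
  next
    assume KP: "K \<in> P"
    show "K \<inter> C \<noteq> {}"
    proof
      assume "K \<inter> C = {}"
      then have "K \<subseteq> \<Union>N" using openin_subset[OF op[OF K]] by (auto simp: C_def)
      then obtain \<F> where \<F>: "finite \<F>" "\<F> \<subseteq> N" "K \<subseteq> \<Union>\<F>"
        using compactinD[OF cp[OF K], of N] op by (auto simp: N_def)
      then have "\<F> \<subseteq> blocks (KO_space X)" by (auto simp: N_def)
      then have "\<Union>\<F> \<in> P"
        using P'(5)[OF KP _ \<F>(3)] finite_Union_blocks[OF pX \<F>(1)] by simp
      then obtain L where "L \<in> \<F>" "L \<in> P"
        using prime_filter_finite_Union[OF pX P \<F>(1) \<open>\<F> \<subseteq> blocks (KO_space X)\<close>] by blast
      then show False using \<F>(2) by (auto simp: N_def)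
    qed
  qed
  have separate: "\<exists>K\<in>P. K \<inter> D = {}" if D: "closedin X D" "D \<subseteq> C" "D \<noteq> C" for D
  proof -
    obtain z where z: "z \<in> C" "z \<notin> D" using D by blast
    have "openin X (topspace X - D)" using D(1) by (simp add: closedin_def)
    then obtain \<K> where \<K>: "\<K> \<subseteq> compact_opens X" "topspace X - D = \<Union>\<K>"
      by (rule spectral_space_basis[OF X])
    have "z \<in> topspace X - D" using z by (auto simp: C_def)
    then obtain K where K: "K \<in> compact_opens X" "z \<in> K" "K \<inter> D = {}" using \<K> by blast
    then show ?thesis using meet[OF K(1)] z(1) by blast
  qed
  have "irreducible_closed X C"
    unfolding irreducible_closed_def
  proof (intro conjI allI impI)
    show "closedin X C" using op by (auto simp: C_def N_def intro!: closedin_diff)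
    show "C \<noteq> {}" using meet[OF P'(1)[OF P'(2)]] P'(2) by blast
    fix D E assume DE: "closedin X D \<and> closedin X E \<and> C = D \<union> E"
    show "C = D \<or> C = E"
    proof (rule ccontr)
      assume "\<not> (C = D \<or> C = E)"
      then obtain K L where KL: "K \<in> P" "K \<inter> D = {}" "L \<in> P" "L \<inter> E = {}"
        using separate[of D] separate[of E] DE by blast
      then have "K \<inter> L \<in> P" by (simp add: P'(4))
      then have "K \<inter> L \<inter> C \<noteq> {}" using meet P'(1) by blast
      then show False using KL DE by blast
    qed
  qed
  then obtain x where x: "x \<in> topspace X" "C = X closure_of {x}"
    using X by (auto simp: spectral_space_def sober_space_def)
  have "K \<inter> C \<noteq> {} \<longleftrightarrow> x \<in> K" if "K \<in> compact_opens X" for K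
  proof -
    have "K \<inter> X closure_of {x} = {} \<longleftrightarrow> K \<inter> {x} = {}"
      using openin_Int_closure_of_eq_empty[OF op[OF that]] .
    then show ?thesis using x(2) by auto
  qed
  then have "P = point_filter (KO_space X) x"
    using meet P'(1) by (auto simp: point_filter_def)
  then show "\<exists>x\<in>points (KO_space X). P = point_filter (KO_space X) x" using x(1) by auto
qed

section \<open>The isomorphism\<close>

lemma Ob_CPervin:
  "A \<in> Ob CPervin \<longleftrightarrow> pervin_space A \<and> pervin_T0 A \<and> prime_filters_fixed A"
  using complete_pervin_iff_prime_filters_fixed[of A]
  by (auto simp: CPervin_def full_subcategory_def Pervin_def)

lemma CPervin_sel [simp]:
  "Hom CPervin = pervin_hom"
  "Ident CPervin = (\<lambda>A. \<lambda>x\<in>points A. x)"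
  "Comp CPervin = (\<lambda>A B C g f. compose (points A) g f)"
  by (simp_all add: CPervin_def full_subcategory_def Pervin_def)

lemma Spec_sel [simp]:
  "Ob Spec = {X. spectral_space X}"
  "Hom Spec = spectral_hom"
  "Ident Spec = (\<lambda>X. \<lambda>x\<in>topspace X. x)"
  "Comp Spec = (\<lambda>X Y Z g f. compose (topspace X) g f)"
  by (simp_all add: Spec_def)

lemma pervin_hom_ident:
  assumes "pervin_space A"
  shows "(\<lambda>x\<in>points A. x) \<in> pervin_hom A A"
proof -
  have "(\<lambda>x\<in>points A. x) -` T \<inter> points A = T" if "T \<in> blocks A" for T
    using pervin_spaceD(1)[OF assms that] by auto
  then show ?thesis by (auto simp: pervin_hom_def)
qed

lemma pervin_hom_compose:
  assumes f: "f \<in> pervin_hom A B" and g: "g \<in> pervin_hom B C"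
  shows "compose (points A) g f \<in> pervin_hom A C"
proof -
  have fg: "f \<in> points A \<rightarrow>\<^sub>E points B" "g \<in> points B \<rightarrow>\<^sub>E points C"
    using f g by (auto simp: pervin_hom_def)
  have "compose (points A) g f -` T \<inter> points A = f -` (g -` T \<inter> points B) \<inter> points A" for T
    using fg by (auto simp: compose_def)
  moreover have "f -` (g -` T \<inter> points B) \<inter> points A \<in> blocks A" if "T \<in> blocks C" for T
  proof -
    have "g -` T \<inter> points B \<in> blocks B" using g that by (simp add: pervin_hom_def)
    then show ?thesis using f unfolding pervin_hom_def by blast
  qed
  moreover have "compose (points A) g f \<in> points A \<rightarrow>\<^sub>E points C"
    using fg by (auto simp: compose_def)
  ultimately show ?thesis by (simp add: pervin_hom_def)
qed

lemma category_CPervin: "category CPervin"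
proof
  fix A B C D :: "'a pervin" and f g h
  assume "f \<in> Hom CPervin A B" "g \<in> Hom CPervin B C"
  then have "f \<in> points A \<rightarrow> points B" by (auto simp: pervin_hom_def)
  then show "Comp CPervin A C D h (Comp CPervin A B C g f) =
      Comp CPervin A B D (Comp CPervin B C D h g) f"
    by (simp add: compose_assoc)
next
  fix A B :: "'a pervin" and f
  assume "f \<in> Hom CPervin A B"
  then have "f \<in> points A \<rightarrow>\<^sub>E points B" by (auto simp: pervin_hom_def)
  then show "Comp CPervin A B B (Ident CPervin B) f = f" "Comp CPervin A A B f (Ident CPervin A) = f"
    by (auto simp: compose_def fun_eq_iff PiE_def extensional_def)
qed (auto simp: Ob_CPervin pervin_hom_ident pervin_hom_compose)

text \<open>Preimages of compact open sets are open by continuity and compact by assumption; conversely,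
  preimages of all open sets are open because the compact open sets form a basis.\<close>

lemma spectral_hom_eq_pervin_hom:
  assumes X: "spectral_space X" and Y: "spectral_space Y"
  shows "spectral_hom X Y = pervin_hom (KO_space X) (KO_space Y)"
proof (intro equalityI subsetI)
  fix f assume "f \<in> spectral_hom X Y"
  then have f: "f \<in> extensional (topspace X)" "continuous_map X Y f"
    "\<And>K. K \<in> compact_opens Y \<Longrightarrow> compactin X (f -` K \<inter> topspace X)"
    by (auto simp: spectral_hom_def)
  have "f -` K \<inter> topspace X \<in> compact_opens X" if K: "K \<in> compact_opens Y" for K
  proof -
    have "f -` K \<inter> topspace X = {x \<in> topspace X. f x \<in> K}" by auto
    then show ?thesis
      using f(3)[OF K] openin_continuous_map_preimage[OF f(2), of K] K by (simp add: compact_opens_def)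
  qed
  then show "f \<in> pervin_hom (KO_space X) (KO_space Y)"
    using f(1) continuous_map_image_subset_topspace[OF f(2)]
    by (auto simp: pervin_hom_def PiE_def)
next
  fix f assume "f \<in> pervin_hom (KO_space X) (KO_space Y)"
  then have f: "f \<in> topspace X \<rightarrow>\<^sub>E topspace Y"
    "\<And>K. K \<in> compact_opens Y \<Longrightarrow> f -` K \<inter> topspace X \<in> compact_opens X"
    by (auto simp: pervin_hom_def)
  have "openin X {x \<in> topspace X. f x \<in> U}" if U: "openin Y U" for U
  proof -
    obtain \<K> where \<K>: "\<K> \<subseteq> compact_opens Y" "U = \<Union>\<K>"
      by (rule spectral_space_basis[OF Y U])
    then have "{x \<in> topspace X. f x \<in> U} = (\<Union>K\<in>\<K>. f -` K \<inter> topspace X)" by auto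
    moreover have "openin X (f -` K \<inter> topspace X)" if "K \<in> \<K>" for K
      using f(2)[of K] that \<K>(1) by (auto simp: compact_opens_def)
    then have "openin X (\<Union>K\<in>\<K>. f -` K \<inter> topspace X)" by (intro openin_Union) blast
    ultimately show ?thesis by (simp only:)
  qed
  then show "f \<in> spectral_hom X Y"
    using f by (auto simp: spectral_hom_def continuous_map_def compact_opens_def PiE_def)
qed

theorem proposition5p2:
  assumes "prime_ideal_theorem TYPE('a set)"
  shows "category_isomorphism
           (CPervin :: ('a pervin, 'a \<Rightarrow> 'a) cat) (Spec :: ('a topology, 'a \<Rightarrow> 'a) cat)
           U_Pervin KO"
proof -
  have U_ob: "ob_map U_Pervin = pervin_topology" and U_arr: "arr_map U_Pervin A B f = f"
    for A B :: "'a pervin" and f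
    by (simp_all add: U_Pervin_def)
  have KO_ob: "ob_map KO = KO_space" and KO_arr: "arr_map KO X Y g = g"
    for X Y :: "'a topology" and g
    by (simp_all add: KO_def KO_space_def fun_eq_iff)
  have spectral: "spectral_space (pervin_topology A)" if "A \<in> Ob CPervin" for A :: "'a pervin"
    using that spectral_pervin_topology[OF assms] by (simp add: Ob_CPervin)
  have KO_U: "KO_space (pervin_topology A) = A" if "A \<in> Ob CPervin" for A :: "'a pervin"
    using that compact_opens_pervin_topology[OF assms, of A] topspace_pervin_topology[of A]
    by (intro pervin.equality) (simp_all add: Ob_CPervin)
  have KO_closed: "KO_space X \<in> Ob CPervin" if "spectral_space X" for X :: "'a topology"
    using that
    by (simp add: Ob_CPervin pervin_space_KO_space pervin_T0_KO_space prime_filters_fixed_KO_space)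
  have U_points: "topspace (pervin_topology A) = points A" if "A \<in> Ob CPervin" for A :: "'a pervin"
    using that by (simp add: Ob_CPervin topspace_pervin_topology)
  have U_hom: "spectral_hom (pervin_topology A) (pervin_topology B) = pervin_hom A B"
    if "A \<in> Ob CPervin" "B \<in> Ob CPervin" for A B :: "'a pervin"
    using spectral_hom_eq_pervin_hom[OF spectral[OF that(1)] spectral[OF that(2)]] KO_U that by simp
  interpret C: category "CPervin :: ('a pervin, 'a \<Rightarrow> 'a) cat" by (rule category_CPervin)
  \<comment> \<open>along \<open>KO_space\<close> the hom-sets, identities and composites are those of \<open>CPervin\<close>, whose laws carry over\<close>
  interpret S: category "Spec :: ('a topology, 'a \<Rightarrow> 'a) cat"
  proof
    fix X :: "'a topology" assume "X \<in> Ob Spec"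
    then show "Ident Spec X \<in> Hom Spec X X"
      using C.Ident_closed[OF KO_closed, of X] by (simp add: spectral_hom_eq_pervin_hom)
  next
    fix X Y Z :: "'a topology" and f g
    assume "X \<in> Ob Spec" "Y \<in> Ob Spec" "Z \<in> Ob Spec" "f \<in> Hom Spec X Y" "g \<in> Hom Spec Y Z"
    then show "Comp Spec X Y Z g f \<in> Hom Spec X Z"
      using C.Comp_closed[OF KO_closed KO_closed KO_closed, of X Y Z f g]
      by (simp add: spectral_hom_eq_pervin_hom)
  next
    fix X Y :: "'a topology" and f
    assume "X \<in> Ob Spec" "Y \<in> Ob Spec" "f \<in> Hom Spec X Y"
    then show "Comp Spec X Y Y (Ident Spec Y) f = f" "Comp Spec X X Y f (Ident Spec X) = f"
      using C.Comp_Ident_left[OF KO_closed KO_closed, of X Y f]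
        C.Comp_Ident_right[OF KO_closed KO_closed, of X Y f]
      by (simp_all add: spectral_hom_eq_pervin_hom)
  next
    fix W X Y Z :: "'a topology" and f g h
    assume "W \<in> Ob Spec" "X \<in> Ob Spec" "Y \<in> Ob Spec" "Z \<in> Ob Spec"
      "f \<in> Hom Spec W X" "g \<in> Hom Spec X Y" "h \<in> Hom Spec Y Z"
    then show "Comp Spec W Y Z h (Comp Spec W X Y g f) = Comp Spec W X Z (Comp Spec X Y Z h g) f"
      using C.Comp_assoc[OF KO_closed KO_closed KO_closed KO_closed, of W X Y Z f g h]
      by (simp add: spectral_hom_eq_pervin_hom)
  qed
  show ?thesis
    by unfold_locales
      (auto simp: U_ob U_arr KO_ob KO_arr spectral KO_closed KO_U U_hom U_points
        pervin_topology_KO_space spectral_hom_eq_pervin_hom)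
qed

end
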